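(* Let $(E,\|\cdot\|_E)$ be a Banach space of finite cotype and let $p\in[1,\infty)$. There exists a constant $K_p(E)\in(0,\infty)$ such that for any $n\in\mathbb{N}$, every function $f:\{-1,1\}^n\to E$ satisfies $$\big\|f-\mathbb{E}f\big\|_{L_p(\log L)^{p/2}(E)} \leq K_p(E)\left(\int_{\{-1,1\}^n}\Big\|\sum_{i=1}^n\delta_i\,\partial_i f\Big\|_{L_p(E)}^p\,d\sigma_n(\delta)\right)^{1/p}.$$
   Context: $\sigma_n$ is the uniform probability measure on $\{-1,1\}^n$ and $\mathbb{E}f=\int f\,d\sigma_n$. For $f:\{-1,1\}^n\to E$ and $i\in\{1,\dots,n\}$, $\partial_i f(x)=\frac{1}{2}\big(f(x)-f(x_1,\dots,x_{i-1},-x_i,x_{i+1},\dots,x_n)\big)$. For $g:\{-1,1\}^n\to E$, $\|g\|_{L_p(E)}^p=\int\|g(x)\|_E^p\,d\sigma_n(x)$; in particular, for fixed $\delta\in\{-1,1\}^n$, $\|\sum_i\delta_i\partial_i f\|_{L_p(E)}$ is the $L_p(E)$ norm of the function $x\mapsto\sum_i\delta_i\partial_i f(x)$. For $\alpha>0$, the Orlicz norm is $\|g\|_{L_p(\log L)^\alpha(E)}=\inf\{\gamma>0:\int\psi(\|g(x)\|_E/\gamma)\,d\sigma_n(x)\leq1\}$ with $\psi(t)=t^p\log^\alpha(e+t^p)$. *)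

theory Defs
  imports "HOL-Probability.Probability"
begin

text \<open>
  The cube \<open>{-1,1}\<^sup>n\<close> is encoded by extensional functions on the index set \<open>{1..n}\<close>, since the
  dimension \<open>n\<close> is quantified inside the statement. A function on the cube is a function on
  \<^typ>\<open>nat \<Rightarrow> real\<close>; all notions below only use its values on the cube.
\<close>

definition hcube :: "nat \<Rightarrow> (nat \<Rightarrow> real) set" where
  "hcube n = {1..n} \<rightarrow>\<^sub>E {-1, 1}"

definition hcube_measure :: "nat \<Rightarrow> (nat \<Rightarrow> real) measure" where
  "hcube_measure n = uniform_count_measure (hcube n)"

text \<open>
  The Bochner integral of the library requires a second countable space, so for general \<open>E\<close> the
  mean of a function on the cube is written as a finite average.
\<close>

definition hcube_mean :: "nat \<Rightarrow> ((nat \<Rightarrow> real) \<Rightarrow> 'a::real_vector) \<Rightarrow> 'a" where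
  "hcube_mean n f = (\<Sum>x\<in>hcube n. f x) /\<^sub>R real (card (hcube n))"

lemma finite_hcube: "finite (hcube n)"
  by (simp add: hcube_def finite_PiE)

lemma card_hcube: "card (hcube n) = 2 ^ n"
  by (simp add: hcube_def card_PiE numeral_2_eq_2)

lemma integral_hcube_measure:
  fixes f :: "(nat \<Rightarrow> real) \<Rightarrow> 'a::{banach,second_countable_topology}"
  shows "(\<integral>x. f x \<partial>hcube_measure n) = hcube_mean n f"
  by (simp add: hcube_measure_def hcube_mean_def uniform_count_measure_def
      lebesgue_integral_point_measure_finite finite_hcube scaleR_sum_right inverse_eq_divide)

lemma prob_space_hcube_measure: "prob_space (hcube_measure n)"
  unfolding hcube_measure_def
  by (rule prob_space_uniform_count_measure[OF finite_hcube]) (auto simp: hcube_def PiE_eq_empty_iff)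

definition hcube_deriv ::
    "nat \<Rightarrow> ((nat \<Rightarrow> real) \<Rightarrow> 'a::real_vector) \<Rightarrow> (nat \<Rightarrow> real) \<Rightarrow> 'a" where
  "hcube_deriv i f x = (1/2) *\<^sub>R (f x - f (x(i := - x i)))"

definition Lp_norm ::
    "nat \<Rightarrow> real \<Rightarrow> ((nat \<Rightarrow> real) \<Rightarrow> 'a::real_normed_vector) \<Rightarrow> real" where
  "Lp_norm n p g = (\<integral>x. norm (g x) powr p \<partial>hcube_measure n) powr (1/p)"

definition LlogL_fun :: "real \<Rightarrow> real \<Rightarrow> real \<Rightarrow> real" where
  "LlogL_fun p \<alpha> t = t powr p * ln (exp 1 + t powr p) powr \<alpha>"

definition LlogL_norm ::
    "nat \<Rightarrow> real \<Rightarrow> real \<Rightarrow> ((nat \<Rightarrow> real) \<Rightarrow> 'a::real_normed_vector) \<Rightarrow> real" where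
  "LlogL_norm n p \<alpha> g =
     Inf {\<gamma>. \<gamma> > 0 \<and> (\<integral>x. LlogL_fun p \<alpha> (norm (g x) / \<gamma>) \<partial>hcube_measure n) \<le> 1}"

text \<open>
  Rademacher cotype, a property of the normed space carried by the type \<^typ>\<open>'a\<close>. The Rademacher
  average is taken in \<open>L\<^sub>q\<close>; by the Kahane--Khinchine inequality any other \<open>L\<^sub>r\<close>-average with
  \<open>r < \<infinity>\<close> only changes the constant.
\<close>

definition has_cotype :: "'a::real_normed_vector itself \<Rightarrow> real \<Rightarrow> real \<Rightarrow> bool" where
  "has_cotype _ q C \<longleftrightarrow>
     (\<forall>(n::nat) (x :: nat \<Rightarrow> 'a).
        (\<Sum>i=1..n. norm (x i) powr q) powr (1/q)
          \<le> C * Lp_norm n q (\<lambda>\<delta>. \<Sum>i=1..n. \<delta> i *\<^sub>R x i))"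

definition finite_cotype :: "'a::real_normed_vector itself \<Rightarrow> bool" where
  "finite_cotype T \<longleftrightarrow> (\<exists>q C. 2 \<le> q \<and> 0 < C \<and> has_cotype T q C)"

end

theory Submission
  imports Defs
begin

text \<open>
  Write \<open>R\<^sup>p\<close> for the mean over \<open>x\<close> and \<open>\<delta>\<close> of \<open>\<parallel>\<Sum>\<^sub>i \<delta>\<^sub>i \<partial>\<^sub>i f(x)\<parallel>\<^sup>p\<close>. The Poincare inequality
  \<open>\<parallel>f - \<E> f\<parallel>\<^sub>p \<le> C R\<close> follows from the formula of Ivanisvili, van Handel and Volberg, which expresses the
  derivative of the noise operator at flip probability \<open>\<theta>\<close> through sums \<open>\<Sum>\<^sub>i \<eta>\<^sub>i \<partial>\<^sub>i f\<close> with
  centred biased variables \<open>\<eta>\<^sub>i\<close>; finite cotype bounds these by Rademacher sums with an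
  integrable singularity \<open>\<theta>\<^bsup>1/K - 1\<^esup>\<close>.

  The logarithmic gain is then a scalar matter. For \<open>g(x) = \<parallel>f(x) - \<E> f\<parallel>\<close>, a functional norming
  \<open>f(x) - \<E> f\<close> and Khinchine's inequality bound the one-sided gradient
  \<open>(\<Sum>\<^sub>i (g(x) - g(x\<^sup>i))\<^sub>+\<^sup>2)\<^bsup>1/2\<^esup>\<close> by the Rademacher average of \<open>\<parallel>\<Sum>\<^sub>i \<delta>\<^sub>i \<partial>\<^sub>i f(x)\<parallel>\<close>, for every
  Banach space. A one-sided Bobkov inequality for the profile \<open>t \<surd>(1 - ln t)\<close>, applied to the
  truncations of \<open>g\<close> between the levels \<open>2\<^sup>k\<close> and \<open>2\<^bsup>k+1\<^esup>\<close> and summed over \<open>k\<close>, controls the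
  Orlicz norm of \<open>g\<close> by the \<open>L\<^sub>p\<close> norms of \<open>g\<close> and of its one-sided gradient.
\<close>

subsection \<open>Finite weighted means\<close>

text \<open>The obstacle in the scalar half is that a norming functional is tied to its point x: it
  controls how much the norm drops when a coordinate of x is flipped, while a rise is governed by
  the functional at the neighbour. Hence Efron-Stein, Bobkov and the truncation estimates are all
  proved in a form that charges an edge to its higher endpoint alone. The exponent p/2 of the
  logarithm comes from the small-set behaviour of the profile: if the p-th moment of g is at most 1,
  the set where g exceeds 2^k has measure at most 2^(-k), the profile gains a factor of order sqrt k
  there, and k^(p/2) is the size of the logarithmic factor at that level. The resulting bound
  contains a small multiple of the quantity being estimated, which is absorbed. The one-sided
  calculus also yields Kahane's inequality, which the Poincare half needs: cotype acts at an
  exponent above p, and Kahane brings the estimate back to p.\<close>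

definition prob_weight :: "'x set \<Rightarrow> ('x \<Rightarrow> real) \<Rightarrow> bool" where
  "prob_weight A w \<longleftrightarrow> finite A \<and> (\<forall>x\<in>A. 0 \<le> w x) \<and> sum w A = 1"

definition wmean :: "'x set \<Rightarrow> ('x \<Rightarrow> real) \<Rightarrow> ('x \<Rightarrow> 'a) \<Rightarrow> 'a::real_vector" where
  "wmean A w F = (\<Sum>x\<in>A. w x *\<^sub>R F x)"

lemma wmean_cong: "(\<And>x. x \<in> A \<Longrightarrow> F x = G x) \<Longrightarrow> wmean A w F = wmean A w G"
  by (simp add: wmean_def)

lemma wmean_add: "wmean A w (\<lambda>x. F x + G x) = wmean A w F + wmean A w G"
  by (simp add: wmean_def scaleR_add_right sum.distrib)

lemma wmean_diff: "wmean A w (\<lambda>x. F x - G x) = wmean A w F - wmean A w G"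
  by (simp add: wmean_def scaleR_diff_right sum_subtractf)

lemma wmean_scaleR: "wmean A w (\<lambda>x. c *\<^sub>R F x) = c *\<^sub>R wmean A w F"
  by (simp add: wmean_def scaleR_sum_right mult.commute)

lemma wmean_cmult: "wmean A w (\<lambda>x. c * F x) = c * wmean A w F" for c :: real
  using wmean_scaleR[of A w c F] by simp

lemma wmean_sum: "wmean A w (\<lambda>x. \<Sum>k\<in>K. F k x) = (\<Sum>k\<in>K. wmean A w (F k))"
  unfolding wmean_def scaleR_sum_right by (rule sum.swap)

lemma wmean_commute:
  "wmean A w (\<lambda>x. wmean B u (F x)) = wmean B u (\<lambda>y. wmean A w (\<lambda>x. F x y))"
proof -
  have "wmean A w (\<lambda>x. wmean B u (F x)) = (\<Sum>x\<in>A. \<Sum>y\<in>B. (w x * u y) *\<^sub>R F x y)"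
    by (simp add: wmean_def scaleR_sum_right)
  also have "\<dots> = (\<Sum>y\<in>B. \<Sum>x\<in>A. (w x * u y) *\<^sub>R F x y)"
    by (rule sum.swap)
  finally show ?thesis
    by (simp add: wmean_def scaleR_sum_right mult.commute)
qed

lemma linear_wmean: "linear \<phi> \<Longrightarrow> \<phi> (wmean A w F) = wmean A w (\<lambda>x. \<phi> (F x))"
  by (simp add: wmean_def linear_sum linear_scale)

lemma wmean_const: "prob_weight A w \<Longrightarrow> wmean A w (\<lambda>_. c) = c"
  by (simp add: wmean_def prob_weight_def flip: scaleR_sum_left)

lemma wmean_mono:
  fixes F G :: "'x \<Rightarrow> real"
  assumes "prob_weight A w" "\<And>x. x \<in> A \<Longrightarrow> F x \<le> G x"
  shows "wmean A w F \<le> wmean A w G"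
  unfolding wmean_def using assms by (intro sum_mono) (auto simp: prob_weight_def intro: mult_left_mono)

lemma wmean_nonneg:
  fixes F :: "'x \<Rightarrow> real"
  assumes "prob_weight A w" "\<And>x. x \<in> A \<Longrightarrow> 0 \<le> F x"
  shows "0 \<le> wmean A w F"
  using wmean_mono[OF assms(1), of "\<lambda>_. 0" F] assms by (simp add: wmean_const)

lemma norm_wmean_le:
  assumes "prob_weight A w"
  shows "norm (wmean A w F) \<le> wmean A w (\<lambda>x. norm (F x))"
  unfolding wmean_def using assms
  by (intro sum_norm_le) (auto simp: prob_weight_def)

text \<open>Means of nonnegative functions may vanish, so the endpoint 0 must be included; there
  convexity reduces to \<open>s powr p \<le> s\<close> for 0 < s < 1.\<close>

lemma convex_on_powr_nonneg:
  assumes "1 \<le> (p::real)" shows "convex_on {0..} (\<lambda>x. x powr p)"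
proof (rule convex_onI)
  fix t x y :: real
  assume t: "0 < t" "t < 1" and xy: "x \<in> {0..}" "y \<in> {0..}"
  have scale: "(s * z) powr p \<le> s * z powr p" if "0 < s" "s < 1" "0 \<le> z" for s z :: real
  proof -
    have "s powr p \<le> s powr 1" using that assms by (intro powr_mono') auto
    then show ?thesis using that by (simp add: powr_mult mult_right_mono)
  qed
  show "((1 - t) *\<^sub>R x + t *\<^sub>R y) powr p \<le> (1 - t) * x powr p + t * y powr p"
  proof (cases "x = 0 \<or> y = 0")
    case True
    then show ?thesis using scale[of t y] scale[of "1 - t" x] t xy assms by auto
  next
    case False
    then show ?thesis
      using convex_onD[OF powr_convex[OF assms], of t x y] t xy by auto
  qed
qed auto

lemma wmean_powr_le:
  fixes F :: "'x \<Rightarrow> real"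
  assumes "prob_weight A w" "1 \<le> p" "\<And>x. x \<in> A \<Longrightarrow> 0 \<le> F x"
  shows "wmean A w F powr p \<le> wmean A w (\<lambda>x. F x powr p)"
proof -
  have "A \<noteq> {}" using assms(1) by (auto simp: prob_weight_def)
  then show ?thesis
    using convex_on_sum[OF _ _ convex_on_powr_nonneg[OF assms(2)], of A w F] assms
    by (auto simp: wmean_def prob_weight_def)
qed

lemma norm_wmean_powr_le:
  assumes "prob_weight A w" "1 \<le> p"
  shows "norm (wmean A w F) powr p \<le> wmean A w (\<lambda>x. norm (F x) powr p)"
proof -
  have "norm (wmean A w F) powr p \<le> wmean A w (\<lambda>x. norm (F x)) powr p"
    using assms norm_wmean_le by (intro powr_mono2) auto
  also have "\<dots> \<le> wmean A w (\<lambda>x. norm (F x) powr p)"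
    using assms by (intro wmean_powr_le) auto
  finally show ?thesis .
qed

text \<open>The triangle inequality for the Euclidean norm of the pairs (F x, G x). It lets a
  gradient term enter the square root in an induction on the dimension.\<close>

lemma sqrt_wmean_le:
  fixes F G :: "'x \<Rightarrow> real"
  assumes "prob_weight A w"
  shows "sqrt ((wmean A w F)\<^sup>2 + (wmean A w G)\<^sup>2) \<le> wmean A w (\<lambda>x. sqrt ((F x)\<^sup>2 + (G x)\<^sup>2))"
proof -
  have "wmean A w (\<lambda>x. (F x, G x)) = (wmean A w F, wmean A w G)"
    by (simp add: wmean_def sum_prod)
  then show ?thesis
    using norm_wmean_le[OF assms, of "\<lambda>x. (F x, G x)"] by (simp add: norm_Pair)
qed

subsection \<open>Product weights\<close>

definition prod_weight :: "'i set \<Rightarrow> ('v \<Rightarrow> real) \<Rightarrow> ('i \<Rightarrow> 'v) \<Rightarrow> real" where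
  "prod_weight I w x = (\<Prod>i\<in>I. w (x i))"

lemma prob_weight_PiE:
  assumes "finite I" "prob_weight V w"
  shows "prob_weight (I \<rightarrow>\<^sub>E V) (prod_weight I w)"
proof -
  have "(\<Sum>x\<in>I \<rightarrow>\<^sub>E V. \<Prod>i\<in>I. w (x i)) = (\<Prod>i\<in>I. \<Sum>v\<in>V. w v)"
    using assms by (intro prod_sum_PiE[symmetric]) (auto simp: prob_weight_def)
  then show ?thesis
    using assms by (auto simp: prob_weight_def prod_weight_def finite_PiE PiE_iff intro!: prod_nonneg)
qed

lemma wmean_PiE_empty: "wmean ({} \<rightarrow>\<^sub>E V) (prod_weight {} w) F = F (\<lambda>_. undefined)"
  by (simp add: wmean_def prod_weight_def)

lemma wmean_PiE_insert:
  assumes "finite I" "i \<notin> I"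
  shows "wmean (insert i I \<rightarrow>\<^sub>E V) (prod_weight (insert i I) w) F
    = wmean V w (\<lambda>v. wmean (I \<rightarrow>\<^sub>E V) (prod_weight I w) (\<lambda>x. F (x(i := v))))"
proof -
  have upd: "prod_weight I w (x(i := v)) = prod_weight I w x" for x v
    unfolding prod_weight_def using assms by (intro prod.cong) auto
  have "wmean (insert i I \<rightarrow>\<^sub>E V) (prod_weight (insert i I) w) F
    = (\<Sum>(v, x)\<in>V \<times> (I \<rightarrow>\<^sub>E V). prod_weight (insert i I) w (x(i := v)) *\<^sub>R F (x(i := v)))"
    unfolding wmean_def PiE_insert_eq
    by (subst sum.reindex[OF inj_combinator[OF assms(2)]]) (simp add: case_prod_unfold o_def)
  also have "\<dots> = (\<Sum>(v, x)\<in>V \<times> (I \<rightarrow>\<^sub>E V). (w v * prod_weight I w x) *\<^sub>R F (x(i := v)))"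
    using assms upd by (intro sum.cong) (auto simp: prod_weight_def)
  finally show ?thesis
    by (simp add: wmean_def scaleR_sum_right sum.cartesian_product)
qed

text \<open>Combining two independent product-distributed points coordinate by coordinate gives a
  product law again. Used in both directions, this identifies two constructions of the same random
  vector.\<close>

lemma wmean_PiE_pushforward2:
  fixes F :: "('i \<Rightarrow> 'u) \<Rightarrow> 'a::real_vector"
  assumes "finite I" "finite V" "finite V'" "finite U"
    and U: "\<And>a b. a \<in> V \<Longrightarrow> b \<in> V' \<Longrightarrow> h a b \<in> U"
    and u: "\<And>c. c \<in> U \<Longrightarrow> u c = (\<Sum>a\<in>V. \<Sum>b\<in>V'. if h a b = c then w a * w' b else 0)"
  shows "wmean (I \<rightarrow>\<^sub>E V) (prod_weight I w) (\<lambda>x. wmean (I \<rightarrow>\<^sub>E V') (prod_weight I w')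
      (\<lambda>y. F (\<lambda>i\<in>I. h (x i) (y i)))) = wmean (I \<rightarrow>\<^sub>E U) (prod_weight I u) F"
  using assms(1)
proof (induction I arbitrary: F rule: finite_induct)
  case empty
  show ?case unfolding wmean_PiE_empty by (simp add: restrict_def)
next
  case (insert i I)
  have upd: "(\<lambda>j\<in>insert i I. h ((x(i := a)) j) ((y(i := b)) j)) = (\<lambda>j\<in>I. h (x j) (y j))(i := h a b)"
    for x y a b using insert by (auto simp: fun_eq_iff)
  have one: "wmean V w (\<lambda>a. wmean V' w' (\<lambda>b. G (h a b))) = wmean U u G" for G :: "'u \<Rightarrow> 'a"
  proof -
    have "wmean U u G = (\<Sum>c\<in>U. \<Sum>a\<in>V. \<Sum>b\<in>V'. if h a b = c then (w a * w' b) *\<^sub>R G c else 0)"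
      unfolding wmean_def by (intro sum.cong refl) (simp only: u scaleR_sum_left, intro sum.cong refl, simp)
    also have "\<dots> = (\<Sum>a\<in>V. \<Sum>b\<in>V'. \<Sum>c\<in>U. if h a b = c then (w a * w' b) *\<^sub>R G c else 0)"
      by (subst sum.swap, intro sum.cong refl, rule sum.swap)
    also have "\<dots> = (\<Sum>a\<in>V. \<Sum>b\<in>V'. (w a * w' b) *\<^sub>R G (h a b))"
      using assms by (intro sum.cong refl) auto
    finally show ?thesis by (simp add: wmean_def scaleR_sum_right)
  qed
  show ?case
    unfolding wmean_PiE_insert[OF insert.hyps] upd
    wmean_commute[of _ "prod_weight I w" V' w'] insert.IH[of "\<lambda>z. F (z(i := h _ _))"]
    by (rule one)
qed

lemma wmean_PiE_pushforward:
  fixes F :: "('i \<Rightarrow> 'u) \<Rightarrow> 'a::real_vector"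
  assumes "finite I" "finite V" "finite U" "\<And>a. a \<in> V \<Longrightarrow> h a \<in> U"
    and "\<And>c. c \<in> U \<Longrightarrow> u c = (\<Sum>a\<in>V. if h a = c then w a else 0)"
  shows "wmean (I \<rightarrow>\<^sub>E V) (prod_weight I w) (\<lambda>x. F (\<lambda>i\<in>I. h (x i))) = wmean (I \<rightarrow>\<^sub>E U) (prod_weight I u) F"
proof -
  have *: "prob_weight (I \<rightarrow>\<^sub>E {()}) (prod_weight I (\<lambda>_. 1))"
    by (rule prob_weight_PiE[OF assms(1)]) (simp add: prob_weight_def)
  show ?thesis
    using wmean_PiE_pushforward2[of I V "{()}" U "\<lambda>a _. h a" u w "\<lambda>_. 1" F] assms
    unfolding wmean_const[OF *] by (simp cong: if_cong)
qed

subsection \<open>The uniform mean on the cube\<close>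

abbreviation "hcube_weight n \<equiv> prod_weight {1..n} (\<lambda>_::real. 1/2)"

lemma prob_weight_hcube: "prob_weight (hcube n) (hcube_weight n)"
  unfolding hcube_def by (rule prob_weight_PiE) (auto simp: prob_weight_def)

lemma hcube_mean_eq_wmean: "hcube_mean n F = wmean (hcube n) (hcube_weight n) F"
  unfolding hcube_mean_def wmean_def prod_weight_def card_hcube
  by (simp add: power_divide scaleR_sum_right inverse_eq_divide)

lemma hcube_mean_0: "hcube_mean 0 F = F (\<lambda>_. undefined)"
  by (simp add: hcube_mean_def hcube_def)

lemma hcube_mean_Suc:
  "hcube_mean (Suc n) F =
    (1/2) *\<^sub>R (hcube_mean n (\<lambda>x. F (x(Suc n := 1))) + hcube_mean n (\<lambda>x. F (x(Suc n := -1))))"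
proof -
  have "{1..Suc n} = insert (Suc n) {1..n}" by auto
  then show ?thesis
    unfolding hcube_mean_eq_wmean hcube_def
    by (simp add: wmean_PiE_insert) (simp add: wmean_def scaleR_add_right)
qed

lemmas hcube_mean_cong = wmean_cong[where A = "hcube n" and w = "hcube_weight n" for n,
    folded hcube_mean_eq_wmean]
lemmas hcube_mean_add = wmean_add[where A = "hcube n" and w = "hcube_weight n" for n,
    folded hcube_mean_eq_wmean]
lemmas hcube_mean_diff = wmean_diff[where A = "hcube n" and w = "hcube_weight n" for n,
    folded hcube_mean_eq_wmean]
lemmas hcube_mean_cmult = wmean_cmult[where A = "hcube n" and w = "hcube_weight n" for n,
    folded hcube_mean_eq_wmean]
lemmas hcube_mean_sum = wmean_sum[where A = "hcube n" and w = "hcube_weight n" for n,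
    folded hcube_mean_eq_wmean]
lemmas hcube_mean_const = wmean_const[OF prob_weight_hcube, folded hcube_mean_eq_wmean]
lemmas hcube_mean_mono = wmean_mono[OF prob_weight_hcube, folded hcube_mean_eq_wmean]
lemmas hcube_mean_nonneg = wmean_nonneg[OF prob_weight_hcube, folded hcube_mean_eq_wmean]
lemmas hcube_mean_powr_le = wmean_powr_le[OF prob_weight_hcube, folded hcube_mean_eq_wmean]
lemmas sqrt_hcube_mean_le = sqrt_wmean_le[OF prob_weight_hcube, folded hcube_mean_eq_wmean]

section \<open>Coordinatewise multiplication on the cube\<close>

lemma hcube_cases: "x \<in> hcube n \<Longrightarrow> i \<in> {1..n} \<Longrightarrow> x i = -1 \<or> x i = 1"
  by (auto simp: hcube_def PiE_iff)

definition hcube_mult :: "nat \<Rightarrow> (nat \<Rightarrow> real) \<Rightarrow> (nat \<Rightarrow> real) \<Rightarrow> nat \<Rightarrow> real" where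
  "hcube_mult n x y = (\<lambda>i\<in>{1..n}. x i * y i)"

lemma hcube_mult_in:
  "x \<in> hcube n \<Longrightarrow> y \<in> hcube n \<Longrightarrow> hcube_mult n x y \<in> hcube n"
  unfolding hcube_def hcube_mult_def by (intro PiE_I) (force dest: PiE_mem, auto)

lemma hcube_mult_cancel: "x \<in> hcube n \<Longrightarrow> y \<in> hcube n \<Longrightarrow> hcube_mult n (hcube_mult n x y) y = x"
proof
  fix i assume xy: "x \<in> hcube n" "y \<in> hcube n"
  show "hcube_mult n (hcube_mult n x y) y i = x i"
  proof (cases "i \<in> {1..n}")
    case True
    then show ?thesis using hcube_cases[OF xy(2) True] by (auto simp: hcube_mult_def)
  next
    case False
    then show ?thesis using xy(1) by (auto simp: hcube_mult_def hcube_def PiE_iff extensional_def)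
  qed
qed

text \<open>Multiplication by a point of the cube is an involution, so it preserves the uniform
  measure. This absorbs fixed signs into Rademacher signs, and noise into the base point.\<close>

lemma hcube_mean_mult:
  assumes "y \<in> hcube n"
  shows "hcube_mean n (\<lambda>x. F (hcube_mult n x y)) = hcube_mean n F"
proof -
  have "(\<Sum>x\<in>hcube n. F (hcube_mult n x y)) = (\<Sum>x\<in>hcube n. F x)"
    using assms by (intro sum.reindex_bij_witness[of _ "\<lambda>x. hcube_mult n x y" "\<lambda>x. hcube_mult n x y"])
      (auto simp: hcube_mult_in hcube_mult_cancel)
  then show ?thesis by (simp add: hcube_mean_def)
qed

lemma hcube_mean_sgn_flip:
  fixes v :: "nat \<Rightarrow> 'a::real_vector"
  assumes "s \<in> hcube n"
  shows "hcube_mean n (\<lambda>x. F (\<Sum>i=1..n. x i *\<^sub>R s i *\<^sub>R v i)) = hcube_mean n (\<lambda>x. F (\<Sum>i=1..n. x i *\<^sub>R v i))"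
  using hcube_mean_mult[OF assms, of "\<lambda>x. F (\<Sum>i=1..n. x i *\<^sub>R v i)"]
  by (simp add: hcube_mult_def)

subsection \<open>Norming functionals\<close>

text \<open>
  Hahn--Banach via minimal sublinear functionals: a minimal one is linear, and minimality is
  exploited by comparing it with \<open>x \<mapsto> inf\<^sub>t\<^sub>\<ge>\<^sub>0 p (x + t a) - t p a\<close>.
\<close>

definition sublinear :: "('a::real_vector \<Rightarrow> real) \<Rightarrow> bool" where
  "sublinear p \<longleftrightarrow> (\<forall>x y. p (x + y) \<le> p x + p y) \<and> (\<forall>c x. 0 < c \<longrightarrow> p (c *\<^sub>R x) = c * p x)"

lemma sublinear_zero: assumes "sublinear p" shows "p 0 = 0"
  using assms[unfolded sublinear_def, THEN conjunct2, rule_format, of 2 0] by simp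

lemma sublinear_neg: assumes "sublinear p" shows "- p (- x) \<le> p x"
  using assms[unfolded sublinear_def, THEN conjunct1, rule_format, of x "- x"] sublinear_zero[OF assms]
  by simp

text \<open>For odd p, subadditivity at -x and -y is superadditivity at x and y.\<close>

lemma linear_if_sublinear_odd:
  assumes p: "sublinear p" and odd: "\<And>x. p (- x) \<le> - p x"
  shows "linear p"
proof -
  have odd': "p (- x) = - p x" for x using odd[of x] sublinear_neg[OF p, of x] by simp
  have sub: "p (x + y) \<le> p x + p y" for x y using p by (simp add: sublinear_def)
  have add: "p (x + y) = p x + p y" for x y
    using sub[of x y] sub[of "- x" "- y"] odd'[of "x + y"] by (simp add: odd')
  have pos: "p (c *\<^sub>R x) = c * p x" if "0 < c" for c x using p that by (simp add: sublinear_def)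
  have "p (c *\<^sub>R x) = c * p x" for c x
    using pos[of c x] pos[of "- c" x] sublinear_zero[OF p] by (cases c "0::real" rule: linorder_cases) (auto simp: odd')
  then show ?thesis using add by (intro linearI) auto
qed

definition ray_inf :: "('a::real_vector \<Rightarrow> real) \<Rightarrow> 'a \<Rightarrow> 'a \<Rightarrow> real" where
  "ray_inf p a x = (INF t\<in>{0..}. p (x + t *\<^sub>R a) - t * p a)"

lemma ray_inf_lower:
  assumes "sublinear p" "0 \<le> t"
  shows "ray_inf p a x \<le> p (x + t *\<^sub>R a) - t * p a"
  unfolding ray_inf_def
proof (rule cINF_lower)
  \<comment> \<open>Writing t a as (x + t a) - x, subadditivity gives the lower bound -p(-x),
    uniformly in t.\<close>
  show "bdd_below ((\<lambda>t. p (x + t *\<^sub>R a) - t * p a) ` {0..})"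
  proof (rule bdd_belowI2)
    fix t :: real assume t: "t \<in> {0..}"
    have "p ((x + t *\<^sub>R a) + (- x)) \<le> p (x + t *\<^sub>R a) + p (- x)"
      using assms unfolding sublinear_def by blast
    moreover have "p (t *\<^sub>R a) = t * p a"
      using t assms sublinear_zero[OF assms(1)] by (cases "t = 0") (auto simp: sublinear_def)
    ultimately show "- p (- x) \<le> p (x + t *\<^sub>R a) - t * p a" by simp
  qed
qed (use assms in auto)

lemma ray_inf_le: "sublinear p \<Longrightarrow> ray_inf p a x \<le> p x"
  using ray_inf_lower[of p 0 a x] by simp

lemma ray_inf_neg: "sublinear p \<Longrightarrow> ray_inf p a (- a) \<le> - p a"
  using ray_inf_lower[of p 1 a "- a"] sublinear_zero[of p] by simp

lemma sublinear_ray_inf: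
  assumes p: "sublinear p" shows "sublinear (ray_inf p a)"
proof -
  have "ray_inf p a (x + y) \<le> ray_inf p a x + ray_inf p a y" for x y
  proof -
    have "ray_inf p a (x + y) - (p (y + s *\<^sub>R a) - s * p a) \<le> ray_inf p a x" if s: "0 \<le> s" for s
      unfolding ray_inf_def[of p a x]
    proof (rule cINF_greatest)
      fix t :: real assume t: "t \<in> {0..}"
      have "ray_inf p a (x + y) \<le> p ((x + t *\<^sub>R a) + (y + s *\<^sub>R a)) - (t + s) * p a"
        using ray_inf_lower[OF p, of "t + s" a "x + y"] s t by (simp add: algebra_simps)
      also have "p ((x + t *\<^sub>R a) + (y + s *\<^sub>R a)) \<le> p (x + t *\<^sub>R a) + p (y + s *\<^sub>R a)"
        using p unfolding sublinear_def by blast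
      finally show "ray_inf p a (x + y) - (p (y + s *\<^sub>R a) - s * p a) \<le> p (x + t *\<^sub>R a) - t * p a"
        by (simp add: algebra_simps)
    qed simp
    then have "ray_inf p a (x + y) - ray_inf p a x \<le> ray_inf p a y"
      unfolding ray_inf_def[of p a y] by (intro cINF_greatest) (auto simp: algebra_simps)
    then show ?thesis by simp
  qed
  moreover have le: "ray_inf p a (c *\<^sub>R x) \<le> c * ray_inf p a x" if c: "0 < c" for c x
  proof -
    have "ray_inf p a (c *\<^sub>R x) / c \<le> ray_inf p a x"
      unfolding ray_inf_def[of p a x]
    proof (rule cINF_greatest)
      fix t :: real assume t: "t \<in> {0..}"
      have "ray_inf p a (c *\<^sub>R x) \<le> p (c *\<^sub>R (x + t *\<^sub>R a)) - (c * t) * p a"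
        using ray_inf_lower[OF p, of "c * t" a "c *\<^sub>R x"] c t by (simp add: algebra_simps)
      also have "p (c *\<^sub>R (x + t *\<^sub>R a)) = c * p (x + t *\<^sub>R a)"
        using p c unfolding sublinear_def by blast
      finally show "ray_inf p a (c *\<^sub>R x) / c \<le> p (x + t *\<^sub>R a) - t * p a"
        using c by (subst pos_divide_le_eq[OF c]) (simp add: algebra_simps)
    qed simp
    then show ?thesis using c by (simp add: divide_le_eq mult.commute)
  qed
  moreover have "c * ray_inf p a x \<le> ray_inf p a (c *\<^sub>R x)" if "0 < c" for c x
    using le[of "inverse c" "c *\<^sub>R x"] that by (simp add: field_simps)
  ultimately show ?thesis unfolding sublinear_def by (meson order_antisym)
qed

text \<open>Zorn's lemma for the reversed pointwise order. The infimum of a chain is finite because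
  every sublinear q below p satisfies q x \<ge> -p(-x).\<close>

lemma minimal_sublinear_exists:
  assumes p: "sublinear (p :: 'a::real_vector \<Rightarrow> real)"
  obtains m where "sublinear m" "m \<le> p" "\<And>q. sublinear q \<Longrightarrow> q \<le> m \<Longrightarrow> q = m"
proof -
  define A where "A = {q. sublinear q \<and> q \<le> p}"
  have "\<exists>m\<in>A. \<forall>a\<in>A. a \<le> m \<longrightarrow> a = m"
  proof (rule predicate_Zorn[of A "\<lambda>x y. y \<le> x"])
    show "partial_order_on A (relation_of (\<lambda>x y. y \<le> x) A)"
      by (rule partial_order_on_relation_ofI) auto
    fix C assume C: "C \<in> Chains (relation_of (\<lambda>x y. y \<le> x) A)"
    then have CA: "C \<subseteq> A" and ch: "\<And>q r. q \<in> C \<Longrightarrow> r \<in> C \<Longrightarrow> q \<le> r \<or> r \<le> q"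
      unfolding Chains_def relation_of_def by blast+
    show "\<exists>u\<in>A. \<forall>a\<in>C. u \<le> a"
    proof (cases "C = {}")
      case True
      then show ?thesis using p by (auto simp: A_def)
    next
      case False
      define u where "u x = (INF q\<in>C. q x)" for x
      have bdd: "bdd_below ((\<lambda>q. q x) ` C)" for x
      proof (rule bdd_belowI2)
        fix q assume "q \<in> C"
        then have q: "sublinear q" "q \<le> p" using CA by (auto simp: A_def)
        show "- p (- x) \<le> q x" using sublinear_neg[OF q(1), of x] le_funD[OF q(2), of "- x"] by simp
      qed
      have lower: "u x \<le> q x" if "q \<in> C" for q x
        unfolding u_def using bdd that by (rule cINF_lower)
      have greatest: "c \<le> u x" if "\<And>q. q \<in> C \<Longrightarrow> c \<le> q x" for c x
        unfolding u_def using False that by (rule cINF_greatest)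
      have sub: "q (x + y) \<le> q x + q y" "0 < c \<Longrightarrow> q (c *\<^sub>R x) = c * q x" if "q \<in> C" for q x y c
        using that CA by (auto simp: A_def sublinear_def)
      have "u (x + y) \<le> u x + u y" for x y
      proof -
        \<comment> \<open>Of two members of a chain, the smaller one serves for both
          summands.\<close>
        have "u (x + y) \<le> q x + r y" if qr: "q \<in> C" "r \<in> C" for q r
        proof (cases "q \<le> r")
          case True
          then show ?thesis using lower[OF qr(1), of "x + y"] sub(1)[OF qr(1), of x y] le_funD[OF True, of y] by simp
        next
          case False
          then have "r \<le> q" using ch qr by blast
          then show ?thesis using lower[OF qr(2), of "x + y"] sub(1)[OF qr(2), of x y] le_funD[of r q x] by simp
        qed
        then have "u (x + y) - r y \<le> u x" if "r \<in> C" for r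
          using that by (intro greatest) (simp add: algebra_simps)
        then have "u (x + y) - u x \<le> u y"
          by (intro greatest) (simp add: algebra_simps)
        then show ?thesis by simp
      qed
      moreover have le: "c * u x \<le> u (c *\<^sub>R x)" if "0 < c" for c x
        using that lower by (intro greatest) (simp add: sub(2))
      moreover have "u (c *\<^sub>R x) \<le> c * u x" if "0 < c" for c x
        using le[of "inverse c" "c *\<^sub>R x"] that by (simp add: field_simps)
      ultimately have "sublinear u" unfolding sublinear_def by (meson order_antisym)
      moreover have "u \<le> p"
      proof (rule le_funI)
        fix x
        obtain q where "q \<in> C" using False by blast
        then show "u x \<le> p x" using lower[of q x] CA by (auto simp: A_def le_fun_def intro: order_trans)
      qed
      ultimately show ?thesis using lower by (auto simp: A_def le_fun_def)
    qed
  qed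
  then show thesis using that by (auto simp: A_def)
qed

text \<open>The minimal functional is taken below \<open>ray_inf norm u\<close> rather than below
  the norm: that function is already at most \<open>- norm u\<close> at -u, which forces the value
  \<open>norm u\<close> at u.\<close>

lemma norming_functional:
  fixes u :: "'a::real_normed_vector"
  obtains \<phi> where "bounded_linear \<phi>" "\<phi> u = norm u" "\<And>v. \<bar>\<phi> v\<bar> \<le> norm v"
proof -
  have n: "sublinear (norm :: 'a \<Rightarrow> real)" by (auto simp: sublinear_def norm_triangle_ineq)
  obtain m where m: "sublinear m" "m \<le> ray_inf norm u"
    and min: "\<And>q. sublinear q \<Longrightarrow> q \<le> m \<Longrightarrow> q = m"
    using minimal_sublinear_exists[OF sublinear_ray_inf[OF n]] by blast
  \<comment> \<open>By minimality \<open>ray_inf m a\<close> equals m, so its bound at -a is a bound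
    for m.\<close>
  have "m (- a) \<le> - m a" for a
    using ray_inf_neg[OF m(1), of a] min[OF sublinear_ray_inf[OF m(1)], of a] ray_inf_le[OF m(1), of a]
    by (simp add: le_fun_def)
  then have lin: "linear m" using linear_if_sublinear_odd[OF m(1)] by blast
  have le: "m v \<le> norm v" for v
    using le_funD[OF m(2), of v] ray_inf_le[OF n, of u v] by simp
  have abs: "\<bar>m v\<bar> \<le> norm v" for v
    using le[of v] le[of "- v"] by (simp add: linear_neg[OF lin])
  have "m (- u) \<le> - norm u"
    using le_funD[OF m(2), of "- u"] ray_inf_neg[OF n, of u] by simp
  then have "m u = norm u" using le[of u] by (simp add: linear_neg[OF lin])
  moreover have "bounded_linear m"
    using lin abs by (intro bounded_linear_intro[where K = 1]) (auto simp: linear_add linear_scale)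
  ultimately show thesis using abs that by blast
qed

subsection \<open>Scalar Rademacher sums\<close>

lemma hcube_sum_Suc:
  fixes a :: "nat \<Rightarrow> 'a::real_vector"
  shows "(\<Sum>i=1..Suc n. (x(Suc n := s)) i *\<^sub>R a i) = (\<Sum>i=1..n. x i *\<^sub>R a i) + s *\<^sub>R a (Suc n)"
proof -
  have "(\<Sum>i=1..n. (x(Suc n := s)) i *\<^sub>R a i) = (\<Sum>i=1..n. x i *\<^sub>R a i)"
    by (intro sum.cong) auto
  then show ?thesis by simp
qed

lemma rademacher_moment2:
  "hcube_mean n (\<lambda>x. (\<Sum>i=1..n. x i * a i)\<^sup>2) = (\<Sum>i=1..n. (a i)\<^sup>2)"
proof (induction n)
  case (Suc n)
  have "hcube_mean (Suc n) (\<lambda>x. (\<Sum>i=1..Suc n. x i * a i)\<^sup>2)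
    = (1/2) * hcube_mean n (\<lambda>x. ((\<Sum>i=1..n. x i * a i) + a (Suc n))\<^sup>2 + ((\<Sum>i=1..n. x i * a i) - a (Suc n))\<^sup>2)"
    using hcube_sum_Suc[of _ n 1 a] hcube_sum_Suc[of _ n "-1" a]
    by (simp add: hcube_mean_Suc hcube_mean_add del: sum.cl_ivl_Suc fun_upd_apply)
  also have "\<dots> = (1/2) * hcube_mean n (\<lambda>x. 2 * (\<Sum>i=1..n. x i * a i)\<^sup>2 + 2 * (a (Suc n))\<^sup>2)"
    by (simp add: power2_eq_square algebra_simps)
  also have "\<dots> = (\<Sum>i=1..Suc n. (a i)\<^sup>2)"
    unfolding hcube_mean_add hcube_mean_cmult hcube_mean_const Suc by simp
  finally show ?case .
qed (simp add: hcube_mean_0)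

text \<open>The constant 3 is the Gaussian fourth moment. The induction closes because 3 s^2 + 6 b^2
  s + b^4 \<le> 3 (s + b^2)^2.\<close>

lemma rademacher_moment4:
  "hcube_mean n (\<lambda>x. (\<Sum>i=1..n. x i * a i) ^ 4) \<le> 3 * (\<Sum>i=1..n. (a i)\<^sup>2)\<^sup>2"
proof (induction n)
  case (Suc n)
  define b where "b = a (Suc n)"
  define s where "s = (\<Sum>i=1..n. (a i)\<^sup>2)"
  have alg: "(X + b) ^ 4 + (X - b) ^ 4 = 2 * X ^ 4 + (12 * b\<^sup>2) * X\<^sup>2 + 2 * b ^ 4" for X :: real
    by (simp add: power4_eq_xxxx power2_eq_square algebra_simps)
  have "hcube_mean (Suc n) (\<lambda>x. (\<Sum>i=1..Suc n. x i * a i) ^ 4)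
    = (1/2) * hcube_mean n (\<lambda>x. ((\<Sum>i=1..n. x i * a i) + b) ^ 4 + ((\<Sum>i=1..n. x i * a i) - b) ^ 4)"
    using hcube_sum_Suc[of _ n 1 a] hcube_sum_Suc[of _ n "-1" a]
    by (simp add: hcube_mean_Suc hcube_mean_add b_def del: sum.cl_ivl_Suc fun_upd_apply)
  also have "\<dots> = hcube_mean n (\<lambda>x. (\<Sum>i=1..n. x i * a i) ^ 4) + 6 * b\<^sup>2 * s + b ^ 4"
    unfolding alg hcube_mean_add hcube_mean_cmult hcube_mean_const rademacher_moment2 s_def by simp
  also have "\<dots> \<le> 3 * s\<^sup>2 + 6 * b\<^sup>2 * s + b ^ 4"
    using Suc by (simp add: s_def)
  also have "\<dots> \<le> 3 * (s + b\<^sup>2)\<^sup>2"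
  proof -
    have "0 \<le> b ^ 4" by simp
    then show ?thesis by (simp add: power4_eq_xxxx power2_eq_square algebra_simps)
  qed
  also have "s + b\<^sup>2 = (\<Sum>i=1..Suc n. (a i)\<^sup>2)" by (simp add: s_def b_def)
  finally show ?case .
qed (simp add: hcube_mean_0)

text \<open>The first moment is bounded below through the second and fourth: y^2 - y^4/4 stays below
  y for y \<ge> 0, and this is applied to y = |X|/(2s).\<close>

lemma khinchine:
  "sqrt (\<Sum>i=1..n. (a i)\<^sup>2) \<le> 5 * hcube_mean n (\<lambda>x. \<bar>\<Sum>i=1..n. x i * a i\<bar>)"
proof -
  define s where "s = sqrt (\<Sum>i=1..n. (a i)\<^sup>2)"
  define X where "X x = (\<Sum>i=1..n. x i * a i)" for x
  have s2: "s\<^sup>2 = (\<Sum>i=1..n. (a i)\<^sup>2)" by (simp add: s_def sum_nonneg)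
  show ?thesis
  proof (cases "s = 0")
    case True
    then show ?thesis
      using hcube_mean_nonneg[of n "\<lambda>x. \<bar>X x\<bar>"] unfolding X_def[symmetric] s_def[symmetric] by simp
  next
    case False
    then have "0 < s" by (simp add: s_def sum_nonneg less_le)
    have elem: "y\<^sup>2 - y ^ 4 / 4 \<le> y" if "0 \<le> y" for y :: real
    proof -
      \<comment> \<open>The cubic y^3 - 4y + 4 has its minimum at 2/sqrt 3, close to 6/5; (y - c)^2
        (y + 2c) = y^3 - 3 c^2 y + 2 c^3 with c = 6/5 isolates it with rational
        coefficients.\<close>
      have "0 \<le> y * ((y - 6/5)\<^sup>2 * (y + 12/5))" using that by simp
      moreover have "0 \<le> y * (8/25 * y + 68/125)" using that by simp
      moreover have "y * ((y - 6/5)\<^sup>2 * (y + 12/5)) + y * (8/25 * y + 68/125) = y * (y ^ 3 - 4 * y + 4)"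
        by (simp add: power3_eq_cube power2_eq_square field_simps)
      ultimately have "0 \<le> y * (y ^ 3 - 4 * y + 4)" by linarith
      then show ?thesis by (simp add: power4_eq_xxxx power3_eq_cube power2_eq_square algebra_simps)
    qed
    have "(X x)\<^sup>2 / (4 * s\<^sup>2) - X x ^ 4 / (64 * s ^ 4) \<le> \<bar>X x\<bar> / (2 * s)" for x
      using elem[of "\<bar>X x\<bar> / (2 * s)"] \<open>0 < s\<close> by (simp add: power_divide power_mult_distrib)
    then have "hcube_mean n (\<lambda>x. 1 / (4 * s\<^sup>2) * (X x)\<^sup>2 - 1 / (64 * s ^ 4) * X x ^ 4)
      \<le> hcube_mean n (\<lambda>x. 1 / (2 * s) * \<bar>X x\<bar>)"
      by (intro hcube_mean_mono) simp
    then have "1 / (4 * s\<^sup>2) * s\<^sup>2 - 1 / (64 * s ^ 4) * hcube_mean n (\<lambda>x. X x ^ 4)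
      \<le> 1 / (2 * s) * hcube_mean n (\<lambda>x. \<bar>X x\<bar>)"
      unfolding hcube_mean_diff hcube_mean_cmult s2 X_def rademacher_moment2 .
    moreover have "1 / (64 * s ^ 4) * hcube_mean n (\<lambda>x. X x ^ 4) \<le> 1 / (64 * s ^ 4) * (3 * (s\<^sup>2)\<^sup>2)"
      unfolding s2 X_def by (intro mult_left_mono rademacher_moment4) (use \<open>0 < s\<close> in auto)
    moreover have "1 / (64 * s ^ 4) * (3 * (s\<^sup>2)\<^sup>2) = 3 / 64"
      using \<open>0 < s\<close> by (simp add: power2_eq_square power4_eq_xxxx)
    moreover have "1 / (4 * s\<^sup>2) * s\<^sup>2 = 1 / 4"
      using \<open>0 < s\<close> by simp
    \<comment> \<open>1/4 - 3/64 = 13/64 is rounded down to 1/10, which yields the constant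
      5.\<close>
    ultimately have "1 / 10 \<le> 1 / (2 * s) * hcube_mean n (\<lambda>x. \<bar>X x\<bar>)"
      by linarith
    then show ?thesis
      unfolding s_def[symmetric] X_def[symmetric] using \<open>0 < s\<close> by (simp add: field_simps)
  qed
qed

subsection \<open>One-sided gradients\<close>

text \<open>Each edge counts only at its endpoint with the larger value. Unlike in
  \<open>hcube_deriv\<close>, the differences carry no factor 1/2.\<close>

definition upgrad2 :: "nat \<Rightarrow> ((nat \<Rightarrow> real) \<Rightarrow> real) \<Rightarrow> (nat \<Rightarrow> real) \<Rightarrow> real" where
  "upgrad2 n h x = (\<Sum>i=1..n. (max 0 (h x - h (x(i := - x i))))\<^sup>2)"

lemma upgrad2_nonneg: "0 \<le> upgrad2 n h x"
  by (simp add: upgrad2_def sum_nonneg)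

lemma upgrad2_Suc:
  "upgrad2 (Suc n) h (x(Suc n := s)) =
    upgrad2 n (\<lambda>x. h (x(Suc n := s))) x + (max 0 (h (x(Suc n := s)) - h (x(Suc n := - s))))\<^sup>2"
proof -
  have "(\<Sum>i=1..n. (max 0 (h (x(Suc n := s)) - h ((x(Suc n := s))(i := - (x(Suc n := s)) i))))\<^sup>2)
    = upgrad2 n (\<lambda>x. h (x(Suc n := s))) x"
    unfolding upgrad2_def by (intro sum.cong refl) (auto simp: fun_upd_twist)
  then show ?thesis by (simp add: upgrad2_def)
qed

lemma hcube_mean_square_le:
  fixes h :: "(nat \<Rightarrow> real) \<Rightarrow> real"
  shows "(hcube_mean n h)\<^sup>2 \<le> hcube_mean n (\<lambda>x. (h x)\<^sup>2)"
proof -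
  define c where "c = hcube_mean n h"
  have "0 \<le> hcube_mean n (\<lambda>x. (h x - c)\<^sup>2)" by (intro hcube_mean_nonneg) simp
  also have "(\<lambda>x. (h x - c)\<^sup>2) = (\<lambda>x. (h x)\<^sup>2 - (2 * c) * h x + c\<^sup>2)"
    by (simp add: fun_eq_iff power2_eq_square algebra_simps)
  also have "hcube_mean n \<dots> = hcube_mean n (\<lambda>x. (h x)\<^sup>2) - c\<^sup>2"
    unfolding hcube_mean_add hcube_mean_diff hcube_mean_cmult hcube_mean_const
    by (simp add: c_def power2_eq_square)
  finally show ?thesis by (simp add: c_def)
qed

text \<open>(a - b)^2 is the sum of its two one-sided parts, so the one-sided gradient has half the
  mean of the two-sided one, and the usual constant 1/4 becomes 1/2.\<close>

lemma efron_stein_one_sided: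
  "hcube_mean n (\<lambda>x. (h x)\<^sup>2) \<le> (hcube_mean n h)\<^sup>2 + hcube_mean n (upgrad2 n h) / 2"
proof (induction n arbitrary: h)
  case 0
  then show ?case by (simp add: hcube_mean_0 upgrad2_def)
next
  case (Suc n)
  define f g where "f = (\<lambda>x. h (x(Suc n := 1)))" and "g = (\<lambda>x. h (x(Suc n := -1)))"
  have upgrad:
    "hcube_mean (Suc n) (upgrad2 (Suc n) h) = (hcube_mean n (upgrad2 n f) + hcube_mean n (upgrad2 n g)
      + hcube_mean n (\<lambda>x. (max 0 (f x - g x))\<^sup>2) + hcube_mean n (\<lambda>x. (max 0 (g x - f x))\<^sup>2)) / 2"
    unfolding hcube_mean_Suc upgrad2_Suc by (simp add: hcube_mean_add f_def g_def)
  have "(hcube_mean n f - hcube_mean n g)\<^sup>2 \<le> hcube_mean n (\<lambda>x. (f x - g x)\<^sup>2)"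
    using hcube_mean_square_le[of n "\<lambda>x. f x - g x"] by (simp add: hcube_mean_diff)
  also have "(\<lambda>x. (f x - g x)\<^sup>2) = (\<lambda>x. (max 0 (f x - g x))\<^sup>2 + (max 0 (g x - f x))\<^sup>2)"
    by (auto simp: fun_eq_iff max_def power2_commute)
  finally have diff: "(hcube_mean n f - hcube_mean n g)\<^sup>2
    \<le> hcube_mean n (\<lambda>x. (max 0 (f x - g x))\<^sup>2) + hcube_mean n (\<lambda>x. (max 0 (g x - f x))\<^sup>2)"
    by (simp only: hcube_mean_add)
  have "((hcube_mean n f + hcube_mean n g) / 2)\<^sup>2
    = ((hcube_mean n f)\<^sup>2 + (hcube_mean n g)\<^sup>2) / 2 - (hcube_mean n f - hcube_mean n g)\<^sup>2 / 4"
    by (simp add: power2_eq_square field_simps)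
  then show ?case
    using Suc.IH[of f] Suc.IH[of g] diff unfolding upgrad unfolding hcube_mean_Suc
    by (simp add: f_def g_def field_simps)
qed

section \<open>Moments of vector-valued Rademacher sums\<close>

lemma hcube_mean_eq_0D:
  fixes F :: "(nat \<Rightarrow> real) \<Rightarrow> real"
  assumes "hcube_mean n F = 0" "\<And>x. x \<in> hcube n \<Longrightarrow> 0 \<le> F x" "x \<in> hcube n"
  shows "F x = 0"
  using assms sum_nonneg_eq_0_iff[OF finite_hcube, of n F] by (simp add: hcube_mean_def card_hcube)

lemma power_diff_le:
  fixes a b :: real
  assumes "0 \<le> b" "b \<le> a"
  shows "a ^ Suc m - b ^ Suc m \<le> real (Suc m) * a ^ m * (a - b)"
proof (induction m)
  case (Suc m)
  have "a ^ Suc (Suc m) - b ^ Suc (Suc m) = a * (a ^ Suc m - b ^ Suc m) + b ^ Suc m * (a - b)"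
    by (simp add: algebra_simps)
  also have "\<dots> \<le> a * (real (Suc m) * a ^ m * (a - b)) + a ^ Suc m * (a - b)"
    using assms Suc by (intro add_mono mult_left_mono mult_right_mono power_mono) auto
  finally show ?case by (simp add: algebra_simps)
qed simp

text \<open>At the larger endpoint the mean value estimate involves g x alone, so the bound stays
  pointwise; a two-sided gradient would bring in the values at the neighbours.\<close>

lemma upgrad2_power_le:
  assumes g: "\<And>x. 0 \<le> g x"
  shows "upgrad2 n (\<lambda>x. g x ^ Suc m) x \<le> (real (Suc m))\<^sup>2 * g x ^ (2 * m) * upgrad2 n g x"
proof -
  have "(max 0 (g x ^ Suc m - g y ^ Suc m))\<^sup>2 \<le> (real (Suc m) * g x ^ m * max 0 (g x - g y))\<^sup>2" for y
  proof (cases "g y \<le> g x")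
    case True
    have "0 \<le> g x ^ Suc m - g y ^ Suc m" using True g by (simp add: power_mono del: power_Suc)
    then show ?thesis
      using power_diff_le[OF g[of y] True, of m] True by (intro power_mono) (auto simp: max_def simp del: power_Suc)
  next
    case False
    then have "g x ^ Suc m \<le> g y ^ Suc m" using g by (intro power_mono) auto
    then show ?thesis using False by (simp add: max_def del: power_Suc)
  qed
  then show ?thesis
    unfolding upgrad2_def sum_distrib_left
    by (intro sum_mono) (simp add: power_mult_distrib mult.commute[of 2 m] power_mult)
qed

text \<open>
  A functional norming \<open>u\<close> sees only the decrease of the norm from \<open>u\<close> to \<open>u - w\<^sub>i\<close>, which is why
  only one-sided differences are controlled by Rademacher averages.
\<close>

lemma norm_decrease_le_rademacher:
  fixes u :: "'a::real_normed_vector"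
  shows "(\<Sum>i=1..n. (max 0 (norm u - norm (u - w i)))\<^sup>2)
    \<le> 25 * (hcube_mean n (\<lambda>\<delta>. norm (\<Sum>i=1..n. \<delta> i *\<^sub>R w i)))\<^sup>2"
proof -
  obtain \<phi> where \<phi>: "bounded_linear \<phi>" "\<phi> u = norm u" "\<And>v. \<bar>\<phi> v\<bar> \<le> norm v"
    using norming_functional[of u] by blast
  interpret \<phi>: bounded_linear \<phi> by fact
  have "(max 0 (norm u - norm (u - w i)))\<^sup>2 \<le> (\<phi> (w i))\<^sup>2" for i
  proof -
    have "norm u - norm (u - w i) \<le> \<phi> (w i)"
      using \<phi>(2) \<phi>(3)[of "u - w i"] by (simp add: \<phi>.diff)
    then have "max 0 (norm u - norm (u - w i)) \<le> \<bar>\<phi> (w i)\<bar>" by simp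
    then have "(max 0 (norm u - norm (u - w i)))\<^sup>2 \<le> \<bar>\<phi> (w i)\<bar>\<^sup>2" by (intro power_mono) auto
    then show ?thesis by simp
  qed
  then have "(\<Sum>i=1..n. (max 0 (norm u - norm (u - w i)))\<^sup>2) \<le> (\<Sum>i=1..n. (\<phi> (w i))\<^sup>2)"
    by (intro sum_mono)
  also have "\<dots> = (sqrt (\<Sum>i=1..n. (\<phi> (w i))\<^sup>2))\<^sup>2"
    by (simp add: sum_nonneg)
  also have "\<dots> \<le> (5 * hcube_mean n (\<lambda>\<delta>. norm (\<Sum>i=1..n. \<delta> i *\<^sub>R w i)))\<^sup>2"
  proof (intro power_mono)
    have "hcube_mean n (\<lambda>\<delta>. \<bar>\<Sum>i=1..n. \<delta> i * \<phi> (w i)\<bar>) \<le> hcube_mean n (\<lambda>\<delta>. norm (\<Sum>i=1..n. \<delta> i *\<^sub>R w i))"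
      using \<phi>(3)[of "\<Sum>i=1..n. _ i *\<^sub>R w i"] by (intro hcube_mean_mono) (simp add: \<phi>.sum \<phi>.scaleR)
    then show "sqrt (\<Sum>i=1..n. (\<phi> (w i))\<^sup>2) \<le> 5 * hcube_mean n (\<lambda>\<delta>. norm (\<Sum>i=1..n. \<delta> i *\<^sub>R w i))"
      using khinchine[of "\<lambda>i. \<phi> (w i)" n] by linarith
  qed (simp add: sum_nonneg)
  finally show ?thesis by (simp add: power_mult_distrib)
qed

text \<open>A flip of x i moves the sum by 2 x i v i, and the signs x i disappear by symmetry; 100
  is 25 times 2^2. A pointwise gradient bound by the first moment is the input for Kahane's
  inequality.\<close>

lemma upgrad2_rademacher_norm_le:
  fixes v :: "nat \<Rightarrow> 'a::real_normed_vector"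
  assumes x: "x \<in> hcube n"
  shows "upgrad2 n (\<lambda>x. norm (\<Sum>i=1..n. x i *\<^sub>R v i)) x
    \<le> 100 * (hcube_mean n (\<lambda>x. norm (\<Sum>i=1..n. x i *\<^sub>R v i)))\<^sup>2"
proof -
  have "(\<Sum>j=1..n. (x(i := - x i)) j *\<^sub>R v j) = (\<Sum>j=1..n. x j *\<^sub>R v j) - (2 * x i) *\<^sub>R v i"
    if "i \<in> {1..n}" for i
  proof -
    have "(\<Sum>j=1..n. (x(i := - x i)) j *\<^sub>R v j) = (\<Sum>j=1..n. x j *\<^sub>R v j - (if j = i then (2 * x i) *\<^sub>R v i else 0))"
      by (intro sum.cong) (auto simp flip: scaleR_diff_left)
    then show ?thesis using that by (simp add: sum_subtractf)
  qed
  then have "upgrad2 n (\<lambda>x. norm (\<Sum>i=1..n. x i *\<^sub>R v i)) x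
    \<le> 25 * (hcube_mean n (\<lambda>\<delta>. norm (\<Sum>i=1..n. \<delta> i *\<^sub>R (2 * x i) *\<^sub>R v i)))\<^sup>2"
    using norm_decrease_le_rademacher[of "\<Sum>i=1..n. x i *\<^sub>R v i" "\<lambda>i. (2 * x i) *\<^sub>R v i" n]
    unfolding upgrad2_def by simp
  also have "(\<lambda>\<delta>. norm (\<Sum>i=1..n. \<delta> i *\<^sub>R (2 * x i) *\<^sub>R v i)) = (\<lambda>\<delta>. 2 * norm (\<Sum>i=1..n. \<delta> i *\<^sub>R x i *\<^sub>R v i))"
  proof
    fix \<delta> :: "nat \<Rightarrow> real"
    have "(\<Sum>i=1..n. \<delta> i *\<^sub>R (2 * x i) *\<^sub>R v i) = 2 *\<^sub>R (\<Sum>i=1..n. \<delta> i *\<^sub>R x i *\<^sub>R v i)"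
      by (simp add: scaleR_sum_right mult_ac)
    then show "norm (\<Sum>i=1..n. \<delta> i *\<^sub>R (2 * x i) *\<^sub>R v i) = 2 * norm (\<Sum>i=1..n. \<delta> i *\<^sub>R x i *\<^sub>R v i)"
      by simp
  qed
  also have "hcube_mean n \<dots> = 2 * hcube_mean n (\<lambda>x. norm (\<Sum>i=1..n. x i *\<^sub>R v i))"
    unfolding hcube_mean_cmult by (subst hcube_mean_sgn_flip[OF x, of norm v]) simp
  finally show ?thesis by (simp add: power_mult_distrib)
qed

text \<open>Efron-Stein for \<open>y ^ Suc m\<close>, with y the norm divided by its mean, bounds
  the moment of order 2m + 2 by the squared mean of \<open>y ^ Suc m\<close> and, the gradient of y
  being bounded, by the moment of order 2m.\<close>

lemma kahane:
  "\<exists>c>0. \<forall>n (v :: nat \<Rightarrow> 'a::real_normed_vector).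
    hcube_mean n (\<lambda>x. norm (\<Sum>i=1..n. x i *\<^sub>R v i) ^ (2 * m))
      \<le> c * hcube_mean n (\<lambda>x. norm (\<Sum>i=1..n. x i *\<^sub>R v i)) ^ (2 * m)"
proof (induction m)
  case 0
  then show ?case by (intro exI[of _ 1]) (simp add: hcube_mean_const)
next
  case (Suc m)
  then obtain c where c: "0 < c" "\<And>n (v :: nat \<Rightarrow> 'a).
    hcube_mean n (\<lambda>x. norm (\<Sum>i=1..n. x i *\<^sub>R v i) ^ (2 * m))
      \<le> c * hcube_mean n (\<lambda>x. norm (\<Sum>i=1..n. x i *\<^sub>R v i)) ^ (2 * m)"
    by blast
  define M where "M = real (Suc m)"
  define d where "d = (1 + c)\<^sup>2 + 50 * M\<^sup>2 * c"
  have "hcube_mean n (\<lambda>x. norm (\<Sum>i=1..n. x i *\<^sub>R v i) ^ (2 * Suc m))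
      \<le> d * hcube_mean n (\<lambda>x. norm (\<Sum>i=1..n. x i *\<^sub>R v i)) ^ (2 * Suc m)"
    for n and v :: "nat \<Rightarrow> 'a"
  proof -
    define g where "g = (\<lambda>x. norm (\<Sum>i=1..n. x i *\<^sub>R v i))"
    define a where "a = hcube_mean n g"
    have g: "0 \<le> g x" for x by (simp add: g_def)
    have "0 \<le> a" unfolding a_def by (intro hcube_mean_nonneg g)
    show ?thesis
    proof (cases "a = 0")
      case True
      then have "hcube_mean n (\<lambda>x. g x ^ (2 * Suc m)) = hcube_mean n (\<lambda>x. 0)"
        using g by (intro hcube_mean_cong) (auto simp: a_def dest: hcube_mean_eq_0D)
      then have "hcube_mean n (\<lambda>x. g x ^ (2 * Suc m)) \<le> d * a ^ (2 * Suc m)"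
        using True by (simp add: hcube_mean_const)
      then show ?thesis by (simp only: g_def a_def)
    next
      case False
      with \<open>0 \<le> a\<close> have a: "0 < a" by simp
      define y where "y x = g x / a" for x
      have y: "0 \<le> y x" for x using g a by (simp add: y_def)
      have ym: "hcube_mean n (\<lambda>x. y x ^ (2 * m)) \<le> c"
      proof -
        have "hcube_mean n (\<lambda>x. y x ^ (2 * m)) = hcube_mean n (\<lambda>x. (1 / a ^ (2 * m)) * g x ^ (2 * m))"
          by (simp add: y_def power_divide)
        also have "\<dots> \<le> (1 / a ^ (2 * m)) * (c * a ^ (2 * m))"
          unfolding hcube_mean_cmult using c(2)[of n v] a
          by (intro mult_left_mono) (auto simp: a_def g_def)
        finally show ?thesis using a by simp
      qed
      have "hcube_mean n (\<lambda>x. y x ^ Suc m) \<le> hcube_mean n (\<lambda>x. 1 + y x ^ (2 * m))"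
      \<comment> \<open>m + 1 \<le> 2m only for m \<ge> 1; for m = 0 the normalization makes the
        mean of y equal to 1.\<close>
      proof (cases m)
        case 0
        have "hcube_mean n (\<lambda>x. y x ^ Suc m) = hcube_mean n (\<lambda>x. (1 / a) * g x)"
          by (simp add: y_def 0)
        also have "\<dots> = 1" unfolding hcube_mean_cmult using a by (simp add: a_def)
        finally show ?thesis by (simp add: 0 hcube_mean_const)
      next
        case (Suc k)
        show ?thesis
        proof (intro hcube_mean_mono)
          fix x
          show "y x ^ Suc m \<le> 1 + y x ^ (2 * m)"
          proof (cases "y x \<le> 1")
            case True
            then show ?thesis using y[of x] power_le_one[of "y x" "Suc m"] zero_le_power[OF y, of x "2 * m"] by linarith
          next
            case False
            then have "y x ^ Suc m \<le> y x ^ (2 * m)" using Suc by (intro power_increasing) auto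
            then show ?thesis by simp
          qed
        qed
      qed
      also have "\<dots> \<le> 1 + c"
        using ym by (simp add: hcube_mean_add hcube_mean_const)
      finally have y1: "hcube_mean n (\<lambda>x. y x ^ Suc m) \<le> 1 + c" .
      have up: "upgrad2 n y x \<le> 100" if "x \<in> hcube n" for x
      proof -
        have "upgrad2 n y x = upgrad2 n g x / a\<^sup>2"
        proof -
          have "max 0 (y x - y z) = max 0 (g x - g z) / a" for z
            using a by (auto simp: y_def max_def diff_divide_distrib[symmetric] zero_le_divide_iff divide_le_0_iff)
          then show ?thesis by (simp add: upgrad2_def power_divide sum_divide_distrib)
        qed
        moreover have "upgrad2 n g x \<le> 100 * a\<^sup>2"
          using upgrad2_rademacher_norm_le[OF that, of v] by (simp only: a_def g_def)
        ultimately show ?thesis using a by (simp add: divide_le_eq)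
      qed
      have "hcube_mean n (\<lambda>x. y x ^ (2 * Suc m)) = hcube_mean n (\<lambda>x. (y x ^ Suc m)\<^sup>2)"
        by (simp only: power_even_eq)
      also have "\<dots> \<le> (hcube_mean n (\<lambda>x. y x ^ Suc m))\<^sup>2 + hcube_mean n (upgrad2 n (\<lambda>x. y x ^ Suc m)) / 2"
        by (rule efron_stein_one_sided)
      also have "\<dots> \<le> (1 + c)\<^sup>2 + (100 * M\<^sup>2 * c) / 2"
      proof (intro add_mono power_mono y1 hcube_mean_nonneg divide_right_mono)
        have "hcube_mean n (upgrad2 n (\<lambda>x. y x ^ Suc m)) \<le> hcube_mean n (\<lambda>x. (100 * M\<^sup>2) * y x ^ (2 * m))"
        proof (intro hcube_mean_mono)
          fix x assume x: "x \<in> hcube n"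
          have "upgrad2 n (\<lambda>x. y x ^ Suc m) x \<le> M\<^sup>2 * y x ^ (2 * m) * upgrad2 n y x"
            unfolding M_def by (rule upgrad2_power_le[OF y])
          also have "\<dots> \<le> M\<^sup>2 * y x ^ (2 * m) * 100"
            using up[OF x] y by (intro mult_left_mono) auto
          finally show "upgrad2 n (\<lambda>x. y x ^ Suc m) x \<le> (100 * M\<^sup>2) * y x ^ (2 * m)" by (simp add: mult_ac)
        qed
        also have "\<dots> \<le> (100 * M\<^sup>2) * c" unfolding hcube_mean_cmult using ym by (intro mult_left_mono) auto
        finally show "hcube_mean n (upgrad2 n (\<lambda>x. y x ^ Suc m)) \<le> 100 * M\<^sup>2 * c" .
      qed (use y in auto)
      finally have "hcube_mean n (\<lambda>x. y x ^ (2 * Suc m)) \<le> d" unfolding d_def by linarith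
      moreover have "hcube_mean n (\<lambda>x. y x ^ (2 * Suc m)) = (1 / a ^ (2 * Suc m)) * hcube_mean n (\<lambda>x. g x ^ (2 * Suc m))"
        unfolding hcube_mean_cmult[symmetric] by (simp add: y_def power_divide)
      ultimately have "hcube_mean n (\<lambda>x. g x ^ (2 * Suc m)) \<le> d * a ^ (2 * Suc m)"
        using a by (simp add: divide_le_eq del: power_Suc mult_Suc_right)
      then show ?thesis by (simp only: g_def a_def)
    qed
  qed
  moreover have "0 < d" unfolding d_def using c by (intro add_pos_nonneg) auto
  ultimately show ?case by blast
qed

subsection \<open>Random selectors under finite cotype\<close>

lemma sum_powr_le_powr_sum:
  fixes a :: "'i \<Rightarrow> real"
  assumes "finite A" "\<And>i. i \<in> A \<Longrightarrow> 0 \<le> a i" "1 \<le> t"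
  shows "(\<Sum>i\<in>A. a i powr t) \<le> (\<Sum>i\<in>A. a i) powr t"
proof -
  define S where "S = (\<Sum>i\<in>A. a i)"
  have S: "0 \<le> S" "\<And>i. i \<in> A \<Longrightarrow> a i \<le> S"
    using assms by (auto simp: S_def intro!: sum_nonneg member_le_sum)
  have "(\<Sum>i\<in>A. a i powr t) \<le> (\<Sum>i\<in>A. a i * S powr (t - 1))"
  proof (rule sum_mono)
    fix i assume i: "i \<in> A"
    have "a i powr t = a i * a i powr (t - 1)" using assms i by (simp add: powr_mult_base)
    also have "\<dots> \<le> a i * S powr (t - 1)" using assms i S by (intro mult_left_mono powr_mono2) auto
    finally show "a i powr t \<le> a i * S powr (t - 1)" .
  qed
  also have "\<dots> = S powr t"
    using S(1) by (simp add: powr_mult_base flip: sum_distrib_right S_def)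
  finally show ?thesis by (simp add: S_def)
qed

text \<open>A larger exponent weakens the left side, by the inclusion of l_q in l_r, and strengthens
  the right side, by monotonicity of power means. The freedom in r is used to reach an even integer
  above p.\<close>

lemma has_cotype_powr_le:
  fixes x :: "nat \<Rightarrow> 'a::real_normed_vector"
  assumes cot: "has_cotype TYPE('a) q C" and "0 < q" "q \<le> r" "0 < C"
  shows "(\<Sum>i=1..n. norm (x i) powr r)
    \<le> C powr r * hcube_mean n (\<lambda>\<delta>. norm (\<Sum>i=1..n. \<delta> i *\<^sub>R x i) powr r)"
proof -
  define M where "M = hcube_mean n (\<lambda>\<delta>. norm (\<Sum>i=1..n. \<delta> i *\<^sub>R x i) powr q)"
  have M: "0 \<le> M" unfolding M_def by (intro hcube_mean_nonneg) auto
  have "(\<Sum>i=1..n. norm (x i) powr r) = (\<Sum>i=1..n. (norm (x i) powr q) powr (r / q))"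
    using assms by (simp add: powr_powr)
  also have "\<dots> \<le> (\<Sum>i=1..n. norm (x i) powr q) powr (r / q)"
    using assms by (intro sum_powr_le_powr_sum) auto
  also have "\<dots> = ((\<Sum>i=1..n. norm (x i) powr q) powr (1 / q)) powr r"
    by (simp add: powr_powr)
  also have "\<dots> \<le> (C * M powr (1 / q)) powr r"
    using cot[unfolded has_cotype_def, rule_format, where n = n and x = x] assms
    by (intro powr_mono2) (auto simp: Lp_norm_def integral_hcube_measure M_def)
  also have "\<dots> = C powr r * M powr (r / q)"
    using assms M by (simp add: powr_mult powr_powr)
  also have "M powr (r / q) \<le> hcube_mean n (\<lambda>\<delta>. (norm (\<Sum>i=1..n. \<delta> i *\<^sub>R x i) powr q) powr (r / q))"
    unfolding M_def using assms by (intro hcube_mean_powr_le) auto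
  also have "\<dots> = hcube_mean n (\<lambda>\<delta>. norm (\<Sum>i=1..n. \<delta> i *\<^sub>R x i) powr r)"
    using assms by (simp add: powr_powr)
  finally show ?thesis by (simp add: mult_left_mono)
qed

definition select_weight :: "real \<Rightarrow> real \<Rightarrow> real" where
  "select_weight \<beta> b = (if b = 1 then \<beta> else 1 - \<beta>)"

lemma prob_weight_select:
  "0 \<le> \<beta> \<Longrightarrow> \<beta> \<le> 1 \<Longrightarrow> prob_weight ({1..n} \<rightarrow>\<^sub>E {0, 1}) (prod_weight {1..n} (select_weight \<beta>))"
  for n :: nat by (rule prob_weight_PiE) (auto simp: prob_weight_def select_weight_def)

text \<open>
  Colour the indices independently with \<open>m \<approx> 1/\<beta>\<close> colours of probability \<open>\<beta>\<close> each and one colour for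
  the rest, and apply cotype to the \<open>m + 1\<close> monochromatic partial sums, whose signed sum is again
  distributed as the full Rademacher sum.
\<close>

lemma selector_le:
  fixes v :: "nat \<Rightarrow> 'a::real_normed_vector"
  assumes cot: "\<And>N (x :: nat \<Rightarrow> 'a). (\<Sum>i=1..N. norm (x i) powr r)
      \<le> D * hcube_mean N (\<lambda>\<delta>. norm (\<Sum>i=1..N. \<delta> i *\<^sub>R x i) powr r)"
    and "0 \<le> D" and \<beta>: "0 < \<beta>" "\<beta> \<le> 1"
  shows "wmean ({1..n} \<rightarrow>\<^sub>E {0, 1}) (prod_weight {1..n} (select_weight \<beta>))
      (\<lambda>b. hcube_mean n (\<lambda>x. norm (\<Sum>i=1..n. x i *\<^sub>R b i *\<^sub>R v i) powr r))
    \<le> 2 * \<beta> * D * hcube_mean n (\<lambda>x. norm (\<Sum>i=1..n. x i *\<^sub>R v i) powr r)"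
    (is "?L \<le> _ * ?R")
proof -
  \<comment> \<open>With this number of colours, m \<beta> \<le> 1 leaves a nonnegative weight for
    colour m + 1, and 2 m \<beta> \<ge> 1 costs only the factor 2.\<close>
  define m where "m = nat \<lfloor>1 / \<beta>\<rfloor>"
  have rm: "real m = of_int \<lfloor>1 / \<beta>\<rfloor>" using \<beta> by (simp add: m_def)
  have "1 \<le> \<lfloor>1 / \<beta>\<rfloor>" using \<beta> by simp
  then have m1: "1 \<le> real m" unfolding rm by linarith
  have "real m \<le> 1 / \<beta>" unfolding rm by linarith
  then have m\<beta>: "real m * \<beta> \<le> 1" using \<beta> by (simp add: field_simps)
  have "1 / \<beta> < real m + 1" unfolding rm by linarith
  then have "1 / \<beta> \<le> 2 * real m" using m1 by linarith
  then have m2: "1 \<le> 2 * \<beta> * real m" using \<beta> by (simp add: field_simps)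
  define w where "w k = (if k \<le> m then \<beta> else 1 - real m * \<beta>)" for k :: nat
  have pw: "prob_weight {1..Suc m} w"
  proof -
    have "(\<Sum>k=1..m. w k) = (\<Sum>k=1..m. \<beta>)" by (intro sum.cong) (auto simp: w_def)
    then show ?thesis using \<beta> m\<beta> by (simp add: prob_weight_def w_def)
  qed
  let ?P = "{1..n} \<rightarrow>\<^sub>E {1..Suc m}" and ?w = "prod_weight {1..n} w"
  have pW: "prob_weight ?P ?w" by (rule prob_weight_PiE[OF _ pw]) simp
  define S where "S J k x = (\<Sum>i=1..n. x i *\<^sub>R (if J i = k then 1 else 0) *\<^sub>R v i)"
    for J :: "nat \<Rightarrow> nat" and k and x :: "nat \<Rightarrow> real"
  have colour: "wmean ?P ?w (\<lambda>J. hcube_mean n (\<lambda>x. norm (S J k x) powr r)) = ?L" if k: "k \<in> {1..m}" for k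
  proof -
    have sum_w: "(\<Sum>j=1..Suc m. if j = k then w j else 0) = \<beta>"
      using k by (simp add: w_def)
    have "(\<Sum>j=1..Suc m. w j) = (\<Sum>j=1..Suc m. (if j = k then w j else 0) + (if j = k then 0 else w j))"
      by (intro sum.cong) auto
    then have sum_w': "(\<Sum>j=1..Suc m. if j = k then 0 else w j) = 1 - \<beta>"
      using sum_w pw by (simp only: sum.distrib) (simp add: prob_weight_def)
    have push: "select_weight \<beta> c = (\<Sum>j=1..Suc m. if (if j = k then 1 else 0) = c then w j else 0)"
      if "c \<in> {0, 1}" for c
    proof (cases "c = 1")
      case True
      have "(\<Sum>j=1..Suc m. if (if j = k then 1 else 0) = c then w j else 0)
        = (\<Sum>j=1..Suc m. if j = k then w j else 0)"
        using True by (intro sum.cong) auto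
      then show ?thesis using True sum_w by (simp only: select_weight_def if_True refl)
    next
      case False
      have "(\<Sum>j=1..Suc m. if (if j = k then 1 else 0) = c then w j else 0)
        = (\<Sum>j=1..Suc m. if j = k then 0 else w j)"
        using False that by (intro sum.cong) auto
      then show ?thesis using False sum_w' by (simp only: select_weight_def if_False)
    qed
    have "wmean ?P ?w (\<lambda>J. hcube_mean n (\<lambda>x. norm (\<Sum>i=1..n. x i *\<^sub>R (\<lambda>i\<in>{1..n}. if J i = k then 1 else 0) i *\<^sub>R v i) powr r))
      = ?L"
      using push by (intro wmean_PiE_pushforward[where h = "\<lambda>j. if j = k then 1 else 0"]) auto
    then show ?thesis by (simp add: S_def)
  qed
  \<comment> \<open>The colouring J is frozen here. The signs \<delta> (J i) are absorbed into the x
    i, so cotype returns the full Rademacher sum.\<close>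
  have recolour: "(\<Sum>k=1..Suc m. hcube_mean n (\<lambda>x. norm (S J k x) powr r)) \<le> D * ?R" if J: "J \<in> ?P" for J
  proof -
    have signed: "(\<Sum>k=1..Suc m. \<delta> k *\<^sub>R S J k x) = (\<Sum>i=1..n. x i *\<^sub>R \<delta> (J i) *\<^sub>R v i)" for \<delta> x
    proof -
      have "(\<Sum>k=1..Suc m. \<delta> k *\<^sub>R S J k x)
        = (\<Sum>i=1..n. \<Sum>k=1..Suc m. if J i = k then x i *\<^sub>R \<delta> k *\<^sub>R v i else 0)"
        unfolding S_def scaleR_sum_right
        by (subst sum.swap, intro sum.cong refl) (auto simp: mult.commute)
      also have "\<dots> = (\<Sum>i=1..n. x i *\<^sub>R \<delta> (J i) *\<^sub>R v i)"
        using J by (intro sum.cong refl) (auto simp: PiE_iff simp del: sum.cl_ivl_Suc)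
      finally show ?thesis .
    qed
    have flip: "hcube_mean n (\<lambda>x. norm (\<Sum>k=1..Suc m. \<delta> k *\<^sub>R S J k x) powr r) = ?R" if \<delta>: "\<delta> \<in> hcube (Suc m)" for \<delta>
    proof -
      have "(\<lambda>i\<in>{1..n}. \<delta> (J i)) \<in> hcube n"
        using J \<delta> unfolding hcube_def by (fastforce simp: PiE_iff)
      from hcube_mean_sgn_flip[OF this, of "\<lambda>z. norm z powr r" v] show ?thesis
        unfolding signed by simp
    qed
    have "(\<Sum>k=1..Suc m. hcube_mean n (\<lambda>x. norm (S J k x) powr r))
      = hcube_mean n (\<lambda>x. \<Sum>k=1..Suc m. norm (S J k x) powr r)"
      by (rule hcube_mean_sum[symmetric])
    also have "\<dots> \<le> hcube_mean n (\<lambda>x. D * hcube_mean (Suc m) (\<lambda>\<delta>. norm (\<Sum>k=1..Suc m. \<delta> k *\<^sub>R S J k x) powr r))"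
      by (intro hcube_mean_mono cot)
    also have "\<dots> = D * hcube_mean (Suc m) (\<lambda>\<delta>. hcube_mean n (\<lambda>x. norm (\<Sum>k=1..Suc m. \<delta> k *\<^sub>R S J k x) powr r))"
      unfolding hcube_mean_cmult unfolding hcube_mean_eq_wmean by (subst wmean_commute) simp
    also have "\<dots> = D * hcube_mean (Suc m) (\<lambda>\<delta>. ?R)"
      by (intro arg_cong[of _ _ "(*) D"] hcube_mean_cong flip)
    finally show ?thesis by (simp only: hcube_mean_const)
  qed
  \<comment> \<open>The first m colour classes all have the law of a \<beta>-selector; these m equal
    terms supply the factor of order 1/\<beta>.\<close>
  have "real m * ?L = (\<Sum>k=1..m. ?L)" by simp
  also have "\<dots> = (\<Sum>k=1..m. wmean ?P ?w (\<lambda>J. hcube_mean n (\<lambda>x. norm (S J k x) powr r)))"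
    by (intro sum.cong refl colour[symmetric])
  also have "\<dots> = wmean ?P ?w (\<lambda>J. \<Sum>k=1..m. hcube_mean n (\<lambda>x. norm (S J k x) powr r))"
    by (rule wmean_sum[symmetric])
  also have "\<dots> \<le> wmean ?P ?w (\<lambda>J. D * ?R)"
  proof (rule wmean_mono[OF pW])
    fix J assume J: "J \<in> ?P"
    have "(\<Sum>k=1..m. hcube_mean n (\<lambda>x. norm (S J k x) powr r))
      \<le> (\<Sum>k=1..Suc m. hcube_mean n (\<lambda>x. norm (S J k x) powr r))"
      by (simp add: hcube_mean_nonneg)
    also note recolour[OF J]
    finally show "(\<Sum>k=1..m. hcube_mean n (\<lambda>x. norm (S J k x) powr r)) \<le> D * ?R" .
  qed
  also have "\<dots> = D * ?R" by (rule wmean_const[OF pW])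
  finally have mL: "real m * ?L \<le> D * ?R" .
  have "0 \<le> ?L"
    using \<beta> by (intro wmean_nonneg[OF prob_weight_select] hcube_mean_nonneg) auto
  then have "?L \<le> (2 * \<beta> * real m) * ?L" using m2 by (simp add: mult_le_cancel_right1)
  also have "\<dots> = 2 * \<beta> * (real m * ?L)" by simp
  also have "\<dots> \<le> 2 * \<beta> * (D * ?R)" using mL \<beta> by (intro mult_left_mono) auto
  finally show ?thesis by (simp add: mult_ac)
qed

text \<open>\<open>selector_le\<close> is applied at a large exponent K, and Kahane's inequality
  leads back to p. Taking p/K-th powers leaves \<open>\<beta> powr (p / K)\<close>, and any positive
  power keeps the singularity of the noise derivative integrable.\<close>

lemma selector_finite_cotype:
  assumes "finite_cotype TYPE('a::real_normed_vector)" "1 \<le> p"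
  obtains K :: nat and B :: real where "0 < K" "0 < B" and
    "\<And>n (v :: nat \<Rightarrow> 'a) \<beta>. 0 < \<beta> \<Longrightarrow> \<beta> \<le> 1 \<Longrightarrow>
      wmean ({1..n} \<rightarrow>\<^sub>E {0, 1}) (prod_weight {1..n} (select_weight \<beta>))
        (\<lambda>b. hcube_mean n (\<lambda>x. norm (\<Sum>i=1..n. x i *\<^sub>R b i *\<^sub>R v i) powr p))
      \<le> B * \<beta> powr (p / real K) * hcube_mean n (\<lambda>x. norm (\<Sum>i=1..n. x i *\<^sub>R v i) powr p)"
proof -
  obtain q C where q: "2 \<le> q" "0 < C" "has_cotype TYPE('a) q C"
    using assms(1) by (auto simp: finite_cotype_def)
  obtain m :: nat where m: "max p q \<le> real m" using real_arch_simple by blast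
  \<comment> \<open>Even for \<open>kahane\<close>, at least q for cotype, and at least p for Jensen
    with exponent K/p.\<close>
  define K where "K = 2 * m"
  have m0: "0 < m" using m q by (cases m) auto
  have K: "0 < K" "p \<le> real K" "q \<le> real K" using m q m0 assms by (auto simp: K_def)
  obtain c where c: "0 < c" "\<And>n (v :: nat \<Rightarrow> 'a).
    hcube_mean n (\<lambda>x. norm (\<Sum>i=1..n. x i *\<^sub>R v i) ^ (2 * m))
      \<le> c * hcube_mean n (\<lambda>x. norm (\<Sum>i=1..n. x i *\<^sub>R v i)) ^ (2 * m)"
    using kahane[of m] by blast
  define D where "D = C powr real K"
  have D: "0 < D" using q by (simp add: D_def)
  define B where "B = (2 * D * c) powr (p / K)"
  have B: "0 < B" using D c by (simp add: B_def)
  have "wmean ({1..n} \<rightarrow>\<^sub>E {0, 1}) (prod_weight {1..n} (select_weight \<beta>))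
        (\<lambda>b. hcube_mean n (\<lambda>x. norm (\<Sum>i=1..n. x i *\<^sub>R b i *\<^sub>R v i) powr p))
      \<le> B * \<beta> powr (p / K) * hcube_mean n (\<lambda>x. norm (\<Sum>i=1..n. x i *\<^sub>R v i) powr p)"
      (is "?L \<le> _ * ?R")
    if \<beta>: "0 < \<beta>" "\<beta> \<le> 1" for n \<beta> and v :: "nat \<Rightarrow> 'a"
  proof -
    define a where "a = hcube_mean n (\<lambda>x. norm (\<Sum>i=1..n. x i *\<^sub>R v i))"
    have a: "0 \<le> a" unfolding a_def by (intro hcube_mean_nonneg) auto
    have pow: "t ^ K = t powr real K" if "0 \<le> t" for t :: real
      using that K by (simp add: powr_realpow')
    have pw: "prob_weight ({1..n} \<rightarrow>\<^sub>E {0, 1}) (prod_weight {1..n} (select_weight \<beta>))"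
      using \<beta> by (intro prob_weight_select) auto
    have L0: "0 \<le> ?L" by (intro wmean_nonneg[OF pw] hcube_mean_nonneg) auto
    have "?L powr (K / p) \<le> wmean ({1..n} \<rightarrow>\<^sub>E {0, 1}) (prod_weight {1..n} (select_weight \<beta>))
        (\<lambda>b. (hcube_mean n (\<lambda>x. norm (\<Sum>i=1..n. x i *\<^sub>R b i *\<^sub>R v i) powr p)) powr (K / p))"
      using K assms by (intro wmean_powr_le[OF pw] hcube_mean_nonneg) auto
    also have "\<dots> \<le> wmean ({1..n} \<rightarrow>\<^sub>E {0, 1}) (prod_weight {1..n} (select_weight \<beta>))
        (\<lambda>b. hcube_mean n (\<lambda>x. (norm (\<Sum>i=1..n. x i *\<^sub>R b i *\<^sub>R v i) powr p) powr (K / p)))"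
      using K assms by (intro wmean_mono[OF pw] hcube_mean_powr_le) auto
    also have "\<dots> = wmean ({1..n} \<rightarrow>\<^sub>E {0, 1}) (prod_weight {1..n} (select_weight \<beta>))
        (\<lambda>b. hcube_mean n (\<lambda>x. norm (\<Sum>i=1..n. x i *\<^sub>R b i *\<^sub>R v i) powr K))"
      using assms by (simp add: powr_powr)
    also have "\<dots> \<le> 2 * \<beta> * D * hcube_mean n (\<lambda>x. norm (\<Sum>i=1..n. x i *\<^sub>R v i) powr K)"
      using q K D \<beta> has_cotype_powr_le[OF q(3), of "real K"]
      by (intro selector_le) (auto simp: D_def)
    also have "\<dots> \<le> 2 * \<beta> * D * (c * a powr K)"
    proof (intro mult_left_mono)
      show "hcube_mean n (\<lambda>x. norm (\<Sum>i=1..n. x i *\<^sub>R v i) powr K) \<le> c * a powr K"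
        using c(2)[of n v] unfolding a_def[symmetric] K_def[symmetric] by (simp add: pow a)
    qed (use \<beta> D in auto)
    finally have "?L powr (K / p) \<le> (2 * D * c) * \<beta> * a powr K" by (simp add: mult_ac)
    then have "(?L powr (K / p)) powr (p / K) \<le> ((2 * D * c) * \<beta> * a powr K) powr (p / K)"
      using assms K by (intro powr_mono2) auto
    also have "\<dots> = B * \<beta> powr (p / K) * a powr p"
      using D c \<beta> a K by (simp add: powr_mult powr_powr B_def)
    also have "(?L powr (K / p)) powr (p / K) = ?L" using L0 assms K by (simp add: powr_powr)
    finally have "?L \<le> B * \<beta> powr (p / K) * a powr p" .
    also have "\<dots> \<le> B * \<beta> powr (p / K) * ?R"
      unfolding a_def using assms B by (intro mult_left_mono hcube_mean_powr_le) auto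
    finally show ?thesis .
  qed
  then show thesis using that K B by blast
qed

subsection \<open>The vector-valued Poincare inequality\<close>

text \<open>A crude Young inequality: the cases v \<le> \<epsilon> u and v > \<epsilon> u each
  account for one term on the right. It covers p = 1 and leaves \<epsilon> free for
  absorption.\<close>

lemma powr_mult_le:
  fixes u v :: real
  assumes "0 \<le> u" "0 \<le> v" "0 < \<epsilon>" "1 \<le> p"
  shows "u powr (p - 1) * v \<le> \<epsilon> * u powr p + \<epsilon> powr (1 - p) * v powr p"
proof (cases "v \<le> \<epsilon> * u")
  case True
  have "u powr (p - 1) * v \<le> u powr (p - 1) * (\<epsilon> * u)"
    using True by (intro mult_left_mono) auto
  also have "\<dots> = \<epsilon> * u powr p" using assms by (simp add: powr_mult_base mult_ac)
  finally show ?thesis by (simp add: add_increasing2)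
next
  case False
  have "u powr (p - 1) * v \<le> (v / \<epsilon>) powr (p - 1) * v"
    using False assms by (intro mult_right_mono powr_mono2) (auto simp: field_simps)
  also have "\<dots> = \<epsilon> powr (1 - p) * v powr p"
  proof -
    have "\<epsilon> powr (1 - p) = 1 / \<epsilon> powr (p - 1)"
      using powr_minus_divide[of \<epsilon> "p - 1"] by simp
    then show ?thesis using assms powr_mult_base[of v "p - 1"] by (simp add: powr_divide mult_ac)
  qed
  finally show ?thesis using assms by (simp add: add_increasing)
qed

text \<open>Mass \<theta> at -1 and 1 - \<theta> at 1, written affinely in \<theta>. Thus \<theta> =
  0 is no noise and \<theta> = 1/2 is the uniform measure.\<close>

definition flip_weight :: "real \<Rightarrow> real \<Rightarrow> real" where
  "flip_weight \<theta> s = (1 + s) / 2 - s * \<theta>"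

text \<open>The logarithmic derivative of \<open>flip_weight \<theta> s\<close> in \<open>\<theta>\<close>.\<close>

definition flip_score :: "real \<Rightarrow> real \<Rightarrow> real" where
  "flip_score \<theta> s = ((1 - s) / 2 - \<theta>) / (\<theta> * (1 - \<theta>))"

definition flip_mean :: "nat set \<Rightarrow> real \<Rightarrow> ((nat \<Rightarrow> real) \<Rightarrow> 'a) \<Rightarrow> 'a::real_vector" where
  "flip_mean I \<theta> F = wmean (I \<rightarrow>\<^sub>E {-1, 1}) (prod_weight I (flip_weight \<theta>)) F"

lemma prob_weight_flip:
  "finite I \<Longrightarrow> 0 \<le> \<theta> \<Longrightarrow> \<theta> \<le> 1 \<Longrightarrow> prob_weight (I \<rightarrow>\<^sub>E {-1, 1}) (prod_weight I (flip_weight \<theta>))"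
  by (rule prob_weight_PiE) (auto simp: prob_weight_def flip_weight_def)

lemma flip_mean_insert:
  assumes "finite I" "i \<notin> I"
  shows "flip_mean (insert i I) \<theta> F =
    \<theta> *\<^sub>R flip_mean I \<theta> (\<lambda>x. F (x(i := -1))) + (1 - \<theta>) *\<^sub>R flip_mean I \<theta> (\<lambda>x. F (x(i := 1)))"
  unfolding flip_mean_def wmean_PiE_insert[OF assms] by (simp add: wmean_def[of "{-1, 1}"] flip_weight_def)

lemma flip_mean_empty: "flip_mean {} \<theta> F = F (\<lambda>_. undefined)"
  unfolding flip_mean_def by (rule wmean_PiE_empty)

lemma flip_mean_0: "finite I \<Longrightarrow> flip_mean I 0 F = F (\<lambda>i\<in>I. 1)"
proof (induction I arbitrary: F rule: finite_induct)
  case empty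
  then show ?case by (simp add: flip_mean_empty restrict_def)
next
  case (insert i I)
  have "(\<lambda>j\<in>I. 1)(i := 1) = (\<lambda>j\<in>insert i I. 1::real)" by auto
  then show ?case using insert by (simp add: flip_mean_insert del: restrict_apply)
qed

lemma flip_mean_half: "flip_mean {1..n} (1/2) F = hcube_mean n F"
proof -
  have "flip_weight (1/2) = (\<lambda>_. 1/2)" by (simp add: fun_eq_iff flip_weight_def field_simps)
  then show ?thesis unfolding flip_mean_def hcube_mean_eq_wmean hcube_def by simp
qed

lemma continuous_on_flip_mean:
  fixes F :: "(nat \<Rightarrow> real) \<Rightarrow> 'a::real_normed_vector"
  shows "continuous_on A (\<lambda>\<theta>. flip_mean I \<theta> F)"
  unfolding flip_mean_def wmean_def prod_weight_def flip_weight_def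
  by (intro continuous_intros)

text \<open>The product rule for the weight: differentiating one factor multiplies the weight by the
  score of that coordinate.\<close>

lemma flip_mean_has_vector_derivative:
  fixes F :: "(nat \<Rightarrow> real) \<Rightarrow> 'a::real_normed_vector"
  assumes "finite I" "0 < \<theta>" "\<theta> < 1"
  shows "((\<lambda>\<theta>. flip_mean I \<theta> F) has_vector_derivative
    flip_mean I \<theta> (\<lambda>s. (\<Sum>i\<in>I. flip_score \<theta> (s i)) *\<^sub>R F s)) (at \<theta>)"
  using assms(1)
proof (induction I arbitrary: F rule: finite_induct)
  case empty
  then show ?case by (simp add: flip_mean_empty)
next
  case (insert i I)
  let ?m = "\<lambda>x. \<Sum>i\<in>I. flip_score \<theta> (x i)"
  have score: "flip_score \<theta> (-1) = 1 / \<theta>" "flip_score \<theta> 1 = - 1 / (1 - \<theta>)"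
    using assms by (auto simp: flip_score_def field_simps)
  have split: "flip_mean I \<theta> (\<lambda>x. (\<Sum>j\<in>insert i I. flip_score \<theta> ((x(i := c)) j)) *\<^sub>R F (x(i := c)))
    = flip_score \<theta> c *\<^sub>R flip_mean I \<theta> (\<lambda>x. F (x(i := c))) + flip_mean I \<theta> (\<lambda>x. ?m x *\<^sub>R F (x(i := c)))" for c
  proof -
    have "(\<Sum>j\<in>insert i I. flip_score \<theta> ((x(i := c)) j)) = flip_score \<theta> c + ?m x" for x
    proof -
      have "(\<Sum>j\<in>I. flip_score \<theta> ((x(i := c)) j)) = ?m x" using insert by (intro sum.cong) auto
      then show ?thesis using insert by simp
    qed
    then show ?thesis by (simp add: flip_mean_def scaleR_add_left wmean_add wmean_scaleR del: fun_upd_apply)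
  qed
  have "((\<lambda>\<theta>. \<theta> *\<^sub>R flip_mean I \<theta> (\<lambda>x. F (x(i := -1))) + (1 - \<theta>) *\<^sub>R flip_mean I \<theta> (\<lambda>x. F (x(i := 1))))
    has_vector_derivative
      (\<theta> *\<^sub>R flip_mean I \<theta> (\<lambda>x. ?m x *\<^sub>R F (x(i := -1))) + 1 *\<^sub>R flip_mean I \<theta> (\<lambda>x. F (x(i := -1)))
      + ((1 - \<theta>) *\<^sub>R flip_mean I \<theta> (\<lambda>x. ?m x *\<^sub>R F (x(i := 1))) + (0 - 1) *\<^sub>R flip_mean I \<theta> (\<lambda>x. F (x(i := 1)))))) (at \<theta>)"
    by (intro has_vector_derivative_add has_vector_derivative_scaleR insert.IH derivative_intros)
  also have "\<theta> *\<^sub>R flip_mean I \<theta> (\<lambda>x. ?m x *\<^sub>R F (x(i := -1))) + 1 *\<^sub>R flip_mean I \<theta> (\<lambda>x. F (x(i := -1)))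
      + ((1 - \<theta>) *\<^sub>R flip_mean I \<theta> (\<lambda>x. ?m x *\<^sub>R F (x(i := 1))) + (0 - 1) *\<^sub>R flip_mean I \<theta> (\<lambda>x. F (x(i := 1))))
    = flip_mean (insert i I) \<theta> (\<lambda>s. (\<Sum>i\<in>insert i I. flip_score \<theta> (s i)) *\<^sub>R F s)"
    unfolding flip_mean_insert[OF insert.hyps] split using assms
    by (simp add: score scaleR_add_right scaleR_diff_right)
  finally show ?case unfolding flip_mean_insert[OF insert.hyps] .
qed

text \<open>Mass times score is 1 at -1 and -1 at 1, and these cancel.\<close>

lemma flip_mean_score_invariant:
  assumes "finite I" "i \<in> I" "0 < \<theta>" "\<theta> < 1" "\<And>s. G (s(i := -1)) = G (s(i := 1))"
  shows "flip_mean I \<theta> (\<lambda>s. flip_score \<theta> (s i) *\<^sub>R G s) = 0"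
proof -
  have I: "I = insert i (I - {i})" using assms by auto
  have score: "flip_score \<theta> (-1) = 1 / \<theta>" "flip_score \<theta> 1 = - 1 / (1 - \<theta>)"
    using assms by (auto simp: flip_score_def field_simps)
  show ?thesis
    using assms by (subst I, subst flip_mean_insert)
      (auto simp: flip_mean_def wmean_scaleR, simp add: score)
qed

lemma flip_mean_coord:
  assumes "finite I" "i \<in> I" "0 \<le> \<theta>" "\<theta> \<le> 1"
  shows "flip_mean I \<theta> (\<lambda>s. s i) = 1 - 2 * \<theta>"
proof -
  have I: "I = insert i (I - {i})" using assms by auto
  have "flip_mean (I - {i}) \<theta> (\<lambda>_. c) = c" for c :: real
    unfolding flip_mean_def using assms by (intro wmean_const prob_weight_flip) auto
  then show ?thesis by (subst I, subst flip_mean_insert) (use assms in auto)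
qed

text \<open>
  Symmetrization: \<open>(1 - s)/2 - \<theta>\<close> is the mean of \<open>(s' - s)/2\<close> over an independent copy \<open>s'\<close>, and
  \<open>(s' - s)/2\<close> is distributed as a random sign times a selector of probability \<open>2\<theta>(1 - \<theta>)\<close>.
\<close>

lemma flip_mean_score_le:
  fixes v :: "nat \<Rightarrow> 'a::real_normed_vector"
  assumes \<theta>: "0 < \<theta>" "\<theta> < 1" and p: "1 \<le> p"
  shows "flip_mean {1..n} \<theta> (\<lambda>s. norm (\<Sum>i=1..n. flip_score \<theta> (s i) *\<^sub>R v i) powr p)
    \<le> (1 / (\<theta> * (1 - \<theta>))) powr p *
      wmean ({1..n} \<rightarrow>\<^sub>E {0, 1}) (prod_weight {1..n} (select_weight (2 * \<theta> * (1 - \<theta>))))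
        (\<lambda>b. hcube_mean n (\<lambda>x. norm (\<Sum>i=1..n. x i *\<^sub>R b i *\<^sub>R v i) powr p))"
proof -
  define c where "c = 1 / (\<theta> * (1 - \<theta>))"
  have c: "0 < c" using \<theta> by (simp add: c_def)
  have pw: "prob_weight ({1..n} \<rightarrow>\<^sub>E {-1, 1}) (prod_weight {1..n} (flip_weight \<theta>))"
    using \<theta> by (intro prob_weight_flip) auto
  define F where "F z = norm (\<Sum>i=1..n. z i *\<^sub>R v i) powr p" for z :: "nat \<Rightarrow> real"
  have copy: "(\<Sum>i=1..n. flip_score \<theta> (s i) *\<^sub>R v i)
    = c *\<^sub>R flip_mean {1..n} \<theta> (\<lambda>s'. \<Sum>i=1..n. ((s' i - s i) / 2) *\<^sub>R v i)" for s
  proof -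
    have "flip_mean {1..n} \<theta> (\<lambda>s'. \<Sum>i=1..n. ((s' i - s i) / 2) *\<^sub>R v i)
      = (\<Sum>i=1..n. flip_mean {1..n} \<theta> (\<lambda>s'. ((s' i - s i) / 2) *\<^sub>R v i))"
      unfolding flip_mean_def by (rule wmean_sum)
    also have "\<dots> = (\<Sum>i=1..n. ((1 - s i) / 2 - \<theta>) *\<^sub>R v i)"
    proof (intro sum.cong refl)
      fix i assume i: "i \<in> {1..n}"
      have lin: "linear (\<lambda>t. t *\<^sub>R v i)" by (simp add: linear_iff scaleR_add_left)
      have "flip_mean {1..n} \<theta> (\<lambda>s'. ((s' i - s i) / 2) *\<^sub>R v i)
        = flip_mean {1..n} \<theta> (\<lambda>s'. (1/2) * s' i - s i / 2) *\<^sub>R v i"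
        unfolding flip_mean_def linear_wmean[OF lin] by (simp add: diff_divide_distrib)
      also have "flip_mean {1..n} \<theta> (\<lambda>s'. (1/2) * s' i - s i / 2) = (1 - 2 * \<theta>) / 2 - s i / 2"
        using flip_mean_coord[OF _ i, of \<theta>] \<theta> unfolding flip_mean_def wmean_diff wmean_cmult wmean_const[OF pw] by simp
      also have "\<dots> = (1 - s i) / 2 - \<theta>" by (simp add: field_simps)
      finally show "flip_mean {1..n} \<theta> (\<lambda>s'. ((s' i - s i) / 2) *\<^sub>R v i) = ((1 - s i) / 2 - \<theta>) *\<^sub>R v i" .
    qed
    finally show ?thesis by (simp add: scaleR_sum_right c_def flip_score_def)
  qed
  have "flip_mean {1..n} \<theta> (\<lambda>s. norm (\<Sum>i=1..n. flip_score \<theta> (s i) *\<^sub>R v i) powr p)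
    = flip_mean {1..n} \<theta> (\<lambda>s. c powr p * norm (flip_mean {1..n} \<theta> (\<lambda>s'. \<Sum>i=1..n. ((s' i - s i) / 2) *\<^sub>R v i)) powr p)"
    unfolding copy using c by (simp add: powr_mult)
  also have "\<dots> = c powr p * flip_mean {1..n} \<theta> (\<lambda>s. norm (flip_mean {1..n} \<theta> (\<lambda>s'. \<Sum>i=1..n. ((s' i - s i) / 2) *\<^sub>R v i)) powr p)"
    unfolding flip_mean_def by (rule wmean_cmult)
  also have "\<dots> \<le> c powr p * flip_mean {1..n} \<theta> (\<lambda>s. flip_mean {1..n} \<theta> (\<lambda>s'. norm (\<Sum>i=1..n. ((s' i - s i) / 2) *\<^sub>R v i) powr p))"
    unfolding flip_mean_def using p by (intro mult_left_mono wmean_mono[OF pw] norm_wmean_powr_le[OF pw]) auto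
  also have "flip_mean {1..n} \<theta> (\<lambda>s. flip_mean {1..n} \<theta> (\<lambda>s'. norm (\<Sum>i=1..n. ((s' i - s i) / 2) *\<^sub>R v i) powr p))
    = wmean ({1..n} \<rightarrow>\<^sub>E {-1, 1}) (prod_weight {1..n} (flip_weight \<theta>))
      (\<lambda>s. wmean ({1..n} \<rightarrow>\<^sub>E {-1, 1}) (prod_weight {1..n} (flip_weight \<theta>)) (\<lambda>s'. F (\<lambda>i\<in>{1..n}. (s' i - s i) / 2)))"
    by (simp add: F_def flip_mean_def)
  also have "\<dots> = wmean ({1..n} \<rightarrow>\<^sub>E {-1, 0, 1})
      (prod_weight {1..n} (\<lambda>c. if c = 0 then 1 - 2 * \<theta> * (1 - \<theta>) else \<theta> * (1 - \<theta>))) F"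
    by (intro wmean_PiE_pushforward2[where h = "\<lambda>s s'. (s' - s) / 2"])
      (auto simp: flip_weight_def algebra_simps)
  also have "\<dots> = wmean ({1..n} \<rightarrow>\<^sub>E {-1, 1}) (hcube_weight n)
      (\<lambda>x. wmean ({1..n} \<rightarrow>\<^sub>E {0, 1}) (prod_weight {1..n} (select_weight (2 * \<theta> * (1 - \<theta>)))) (\<lambda>b. F (\<lambda>i\<in>{1..n}. x i * b i)))"
    by (intro wmean_PiE_pushforward2[where h = "(*)", symmetric])
      (auto simp: select_weight_def)
  also have "\<dots> = wmean ({1..n} \<rightarrow>\<^sub>E {0, 1}) (prod_weight {1..n} (select_weight (2 * \<theta> * (1 - \<theta>))))
        (\<lambda>b. hcube_mean n (\<lambda>x. norm (\<Sum>i=1..n. x i *\<^sub>R b i *\<^sub>R v i) powr p))"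
    by (subst wmean_commute) (simp add: hcube_mean_eq_wmean hcube_def F_def)
  finally show ?thesis by (simp add: c_def)
qed

section \<open>The noise operator and its derivative\<close>

definition heat_deriv :: "nat \<Rightarrow> real \<Rightarrow> ((nat \<Rightarrow> real) \<Rightarrow> 'a) \<Rightarrow> (nat \<Rightarrow> real) \<Rightarrow> 'a::real_vector" where
  "heat_deriv n \<theta> f x =
    flip_mean {1..n} \<theta> (\<lambda>s. \<Sum>i=1..n. flip_score \<theta> (s i) *\<^sub>R hcube_deriv i f (hcube_mult n x s))"

text \<open>
  The scores average to zero against functions not depending on the respective coordinate, so
  \<open>f\<close> may be replaced by its discrete derivatives.
\<close>

lemma flip_mean_has_heat_deriv:
  fixes f :: "(nat \<Rightarrow> real) \<Rightarrow> 'a::real_normed_vector"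
  assumes "0 < \<theta>" "\<theta> < 1"
  shows "((\<lambda>\<theta>. flip_mean {1..n} \<theta> (\<lambda>s. f (hcube_mult n x s))) has_vector_derivative heat_deriv n \<theta> f x) (at \<theta>)"
proof -
  define F where "F = (\<lambda>s. f (hcube_mult n x s))"
  have "flip_mean {1..n} \<theta> (\<lambda>s. (\<Sum>i=1..n. flip_score \<theta> (s i)) *\<^sub>R F s)
    = (\<Sum>i=1..n. flip_mean {1..n} \<theta> (\<lambda>s. flip_score \<theta> (s i) *\<^sub>R F s))"
    unfolding flip_mean_def scaleR_sum_left by (rule wmean_sum)
  also have "\<dots> = (\<Sum>i=1..n. flip_mean {1..n} \<theta> (\<lambda>s. flip_score \<theta> (s i) *\<^sub>R hcube_deriv i f (hcube_mult n x s)))"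
  proof (intro sum.cong refl)
    fix i assume i: "i \<in> {1..n}"
    define G where "G s = (1/2) *\<^sub>R (F s + F (s(i := - s i)))" for s
    have upd: "hcube_mult n x (s(i := - s i)) = (hcube_mult n x s)(i := - hcube_mult n x s i)" for s
      using i by (auto simp: hcube_mult_def fun_eq_iff)
    have "flip_score \<theta> (s i) *\<^sub>R F s
      = flip_score \<theta> (s i) *\<^sub>R hcube_deriv i f (hcube_mult n x s) + flip_score \<theta> (s i) *\<^sub>R G s" for s
    proof -
      have "hcube_deriv i f (hcube_mult n x s) + G s = (1/2 + 1/2) *\<^sub>R F s"
        unfolding hcube_deriv_def G_def F_def upd scaleR_add_left by (simp add: scaleR_add_right scaleR_diff_right)
      then show ?thesis by (simp flip: scaleR_add_right)
    qed
    then have "flip_mean {1..n} \<theta> (\<lambda>s. flip_score \<theta> (s i) *\<^sub>R F s)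
      = flip_mean {1..n} \<theta> (\<lambda>s. flip_score \<theta> (s i) *\<^sub>R hcube_deriv i f (hcube_mult n x s))
        + flip_mean {1..n} \<theta> (\<lambda>s. flip_score \<theta> (s i) *\<^sub>R G s)"
      unfolding flip_mean_def by (simp add: wmean_add)
    also have "flip_mean {1..n} \<theta> (\<lambda>s. flip_score \<theta> (s i) *\<^sub>R G s) = 0"
      using i assms by (intro flip_mean_score_invariant) (auto simp: G_def add.commute)
    finally show "flip_mean {1..n} \<theta> (\<lambda>s. flip_score \<theta> (s i) *\<^sub>R F s)
      = flip_mean {1..n} \<theta> (\<lambda>s. flip_score \<theta> (s i) *\<^sub>R hcube_deriv i f (hcube_mult n x s))" by simp
  qed
  also have "\<dots> = heat_deriv n \<theta> f x"
    unfolding flip_mean_def heat_deriv_def by (rule wmean_sum[symmetric])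
  finally show ?thesis
    using flip_mean_has_vector_derivative[OF _ assms, of "{1..n}" F] by (simp add: F_def)
qed

text \<open>Jensen over s brings the norm inside. For fixed s the mean over x is invariant under
  multiplication by s, which decouples the scores from the point at which the derivatives are
  taken.\<close>

lemma heat_deriv_le:
  fixes f :: "(nat \<Rightarrow> real) \<Rightarrow> 'a::real_normed_vector"
  assumes "0 < \<theta>" "\<theta> < 1" "1 \<le> p"
  shows "hcube_mean n (\<lambda>x. norm (heat_deriv n \<theta> f x) powr p) \<le>
    hcube_mean n (\<lambda>x. flip_mean {1..n} \<theta> (\<lambda>s. norm (\<Sum>i=1..n. flip_score \<theta> (s i) *\<^sub>R hcube_deriv i f x) powr p))"
proof -
  have pw: "prob_weight (hcube n) (prod_weight {1..n} (flip_weight \<theta>))"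
    unfolding hcube_def using assms by (intro prob_weight_flip) auto
  have "hcube_mean n (\<lambda>x. norm (heat_deriv n \<theta> f x) powr p) \<le>
    hcube_mean n (\<lambda>x. flip_mean {1..n} \<theta> (\<lambda>s. norm (\<Sum>i=1..n. flip_score \<theta> (s i) *\<^sub>R hcube_deriv i f (hcube_mult n x s)) powr p))"
    unfolding heat_deriv_def flip_mean_def hcube_def[symmetric]
    using assms by (intro hcube_mean_mono norm_wmean_powr_le[OF pw])
  also have "\<dots> = flip_mean {1..n} \<theta> (\<lambda>s. hcube_mean n (\<lambda>x. norm (\<Sum>i=1..n. flip_score \<theta> (s i) *\<^sub>R hcube_deriv i f (hcube_mult n x s)) powr p))"
    unfolding flip_mean_def hcube_mean_eq_wmean by (rule wmean_commute)
  also have "\<dots> = flip_mean {1..n} \<theta> (\<lambda>s. hcube_mean n (\<lambda>x. norm (\<Sum>i=1..n. flip_score \<theta> (s i) *\<^sub>R hcube_deriv i f x) powr p))"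
    unfolding flip_mean_def hcube_def[symmetric]
  proof (intro wmean_cong)
    fix s assume "s \<in> hcube n"
    then show "hcube_mean n (\<lambda>x. norm (\<Sum>i=1..n. flip_score \<theta> (s i) *\<^sub>R hcube_deriv i f (hcube_mult n x s)) powr p)
      = hcube_mean n (\<lambda>x. norm (\<Sum>i=1..n. flip_score \<theta> (s i) *\<^sub>R hcube_deriv i f x) powr p)"
      by (rule hcube_mean_mult)
  qed
  also have "\<dots> = hcube_mean n (\<lambda>x. flip_mean {1..n} \<theta> (\<lambda>s. norm (\<Sum>i=1..n. flip_score \<theta> (s i) *\<^sub>R hcube_deriv i f x) powr p))"
    unfolding flip_mean_def hcube_mean_eq_wmean by (rule wmean_commute)
  finally show ?thesis .
qed

lemma bounded_linear_DERIV:
  fixes \<phi> :: "'a::real_normed_vector \<Rightarrow> real"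
  assumes "bounded_linear \<phi>" "(g has_vector_derivative g') (at t)"
  shows "DERIV (\<lambda>t. \<phi> (g t)) t :> \<phi> g'"
  using bounded_linear.has_vector_derivative[OF assms] by (simp add: has_real_derivative_iff_has_vector_derivative)

text \<open>
  The function \<open>f\<close> is moved to its mean along \<open>\<theta> = t\<^sup>K/2\<close>, \<open>0 \<le> t \<le> 1\<close>; this parametrization makes
  the \<open>L\<^sub>p\<close> norm of the velocity bounded, since at \<open>\<theta>\<close> it is of order \<open>\<theta>\<^bsup>1/K - 1\<^esup>\<close>.
  Dualizing with \<open>\<parallel>f - \<E> f\<parallel>\<^bsup>p - 1\<^esup>\<close> times a norming functional reduces the estimate to the
  scalar mean value theorem.
\<close>

lemma poincare_of_selector:
  fixes f :: "(nat \<Rightarrow> real) \<Rightarrow> 'a::real_normed_vector"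
  assumes p: "1 \<le> p" and K: "0 < K" and B: "0 < B" and
    sel: "\<And>(v :: nat \<Rightarrow> 'a) \<beta>. 0 < \<beta> \<Longrightarrow> \<beta> \<le> 1 \<Longrightarrow>
      wmean ({1..n} \<rightarrow>\<^sub>E {0, 1}) (prod_weight {1..n} (select_weight \<beta>))
        (\<lambda>b. hcube_mean n (\<lambda>x. norm (\<Sum>i=1..n. x i *\<^sub>R b i *\<^sub>R v i) powr p))
      \<le> B * \<beta> powr (p / real K) * hcube_mean n (\<lambda>x. norm (\<Sum>i=1..n. x i *\<^sub>R v i) powr p)"
  shows "hcube_mean n (\<lambda>x. norm (f x - hcube_mean n f) powr p)
    \<le> (4 * real K) powr p * B * hcube_mean n (\<lambda>x. hcube_mean n (\<lambda>\<delta>. norm (\<Sum>i=1..n. \<delta> i *\<^sub>R hcube_deriv i f x) powr p))"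
    (is "?U \<le> _ * ?R")
proof -
  define u where "u x = norm (f x - hcube_mean n f)" for x
  \<comment> \<open>For p = 1 this is the indicator of u x \<noteq> 0, since
    \<open>0 powr 0 = 0\<close>.\<close>
  define a where "a x = u x powr (p - 1)" for x
  have u: "0 \<le> u x" for x by (simp add: u_def)
  have "\<forall>x. \<exists>\<phi>. bounded_linear \<phi> \<and> \<phi> (f x - hcube_mean n f) = u x \<and> (\<forall>v. \<bar>\<phi> v\<bar> \<le> norm v)"
    unfolding u_def using norming_functional by metis
  then obtain \<phi> where \<phi>: "\<And>x. bounded_linear (\<phi> x)" "\<And>x. \<phi> x (f x - hcube_mean n f) = u x"
    "\<And>x v. \<bar>\<phi> x v\<bar> \<le> norm v"
    by metis
  define T where "T x \<theta> = flip_mean {1..n} \<theta> (\<lambda>s. f (hcube_mult n x s))" for x \<theta>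
  \<comment> \<open>Pairing with weights that do not depend on t gives a scalar path whose total
    drop k 0 - k 1 is the quantity to be estimated.\<close>
  define k where "k t = hcube_mean n (\<lambda>x. a x * \<phi> x (T x (t ^ K / 2)))" for t :: real
  define l where "l t = hcube_mean n (\<lambda>x. a x * \<phi> x ((real K * t ^ (K - 1) / 2) *\<^sub>R heat_deriv n (t ^ K / 2) f x))" for t
  have range: "0 < t ^ K / 2" "t ^ K / 2 \<le> 1 / 2" if "0 < t" "t < 1" for t :: real
    using that K by (auto simp: power_le_one)
  have deriv: "DERIV k t :> l t" if t: "0 < t" "t < 1" for t
  proof -
    have "(T x has_vector_derivative heat_deriv n (t ^ K / 2) f x) (at (t ^ K / 2))" for x
      unfolding T_def using range[OF t] by (intro flip_mean_has_heat_deriv) auto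
    moreover have "((\<lambda>t. t ^ K / 2) has_vector_derivative real K * t ^ (K - 1) / 2) (at t)"
      by (auto intro!: derivative_eq_intros simp flip: has_real_derivative_iff_has_vector_derivative)
    ultimately have "((\<lambda>t. T x (t ^ K / 2)) has_vector_derivative
      (real K * t ^ (K - 1) / 2) *\<^sub>R heat_deriv n (t ^ K / 2) f x) (at t)" for x
      using vector_diff_chain_at[of "\<lambda>t. t ^ K / 2" _ t "T x"] by (simp add: o_def)
    then have "DERIV (\<lambda>t. \<phi> x (T x (t ^ K / 2))) t :> \<phi> x ((real K * t ^ (K - 1) / 2) *\<^sub>R heat_deriv n (t ^ K / 2) f x)" for x
      by (rule bounded_linear_DERIV[OF \<phi>(1)])
    then show ?thesis
      unfolding k_def l_def hcube_mean_def real_scaleR_def by (intro DERIV_cmult DERIV_sum)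
  qed
  have cont: "continuous_on {0..1} k"
  proof -
    have "continuous_on {0..1} (\<lambda>t. T x (t ^ K / 2))" for x
      unfolding T_def
      by (rule continuous_on_compose2[OF continuous_on_flip_mean[of UNIV]]) (auto intro!: continuous_intros)
    then have "continuous_on {0..1} (\<lambda>t. \<phi> x (T x (t ^ K / 2)))" for x
      by (rule bounded_linear.continuous_on[OF \<phi>(1)])
    then show ?thesis
      unfolding k_def hcube_mean_def real_scaleR_def by (intro continuous_intros)
  qed
  have k0: "k 0 = hcube_mean n (\<lambda>x. a x * \<phi> x (f x))"
    unfolding k_def
  proof (intro hcube_mean_cong)
    fix x assume "x \<in> hcube n"
    then have "hcube_mult n x (\<lambda>i\<in>{1..n}. 1) = x"
      by (auto simp: hcube_mult_def hcube_def PiE_iff extensional_def)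
    then show "a x * \<phi> x (T x (0 ^ K / 2)) = a x * \<phi> x (f x)"
      by (simp add: T_def flip_mean_0 zero_power[OF K])
  qed
  have k1: "k 1 = hcube_mean n (\<lambda>x. a x * \<phi> x (hcube_mean n f))"
    unfolding k_def
  proof (intro hcube_mean_cong)
    fix x assume x: "x \<in> hcube n"
    have "T x (1 / 2) = hcube_mean n f"
      unfolding T_def flip_mean_half using hcube_mean_mult[OF x, of f] by (simp add: hcube_mult_def mult.commute)
    then show "a x * \<phi> x (T x (1 ^ K / 2)) = a x * \<phi> x (hcube_mean n f)" by simp
  qed
  have U: "?U = k 0 - k 1"
  proof -
    have "u x powr p = a x * \<phi> x (f x) - a x * \<phi> x (hcube_mean n f)" for x
    proof -
      have "a x * \<phi> x (f x) - a x * \<phi> x (hcube_mean n f) = u x * a x"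
        using \<phi>(2)[of x] bounded_linear.linear[OF \<phi>(1)] by (simp add: linear_diff mult.commute flip: right_diff_distrib)
      also have "\<dots> = u x powr p" using u by (simp add: a_def powr_mult_base)
      finally show ?thesis by simp
    qed
    then show ?thesis by (simp add: k0 k1 u_def flip: hcube_mean_diff)
  qed
  \<comment> \<open>One intermediate t suffices, because the velocity bound obtained below is
    independent of t.\<close>
  obtain t where t: "0 < t" "t < 1" "k 1 - k 0 = l t"
  proof -
    have "k differentiable (at x)" if "0 < x" "x < 1" for x
      using deriv[OF that] by (auto simp: real_differentiable_def)
    then obtain d t where "0 < t" "t < 1" "DERIV k t :> d" "k 1 - k 0 = (1 - 0) * d"
      using MVT[OF _ cont] by auto
    then show thesis using that[of t] deriv[of t] DERIV_unique by fastforce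
  qed
  define \<theta> where "\<theta> = t ^ K / 2"
  have \<theta>: "0 < \<theta>" "\<theta> \<le> 1 / 2" using range[OF t(1,2)] by (auto simp: \<theta>_def)
  define \<kappa> where "\<kappa> = real K * t ^ (K - 1) / 2"
  have \<kappa>: "0 < \<kappa>" using K t by (simp add: \<kappa>_def)
  define z where "z x = norm (heat_deriv n \<theta> f x)" for x
  have "?U \<le> hcube_mean n (\<lambda>x. a x * (\<kappa> * z x))"
  proof -
    have "?U = hcube_mean n (\<lambda>x. (-1) * (a x * \<phi> x (\<kappa> *\<^sub>R heat_deriv n \<theta> f x)))"
      using U t(3) unfolding hcube_mean_cmult by (simp add: l_def \<kappa>_def \<theta>_def)
    also have "\<dots> \<le> hcube_mean n (\<lambda>x. a x * (\<kappa> * z x))"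
    proof (intro hcube_mean_mono)
      fix x
      have "- \<phi> x (\<kappa> *\<^sub>R heat_deriv n \<theta> f x) \<le> \<kappa> * z x"
        using \<phi>(3)[of x "\<kappa> *\<^sub>R heat_deriv n \<theta> f x"] \<kappa> by (simp add: z_def)
      then have "a x * - \<phi> x (\<kappa> *\<^sub>R heat_deriv n \<theta> f x) \<le> a x * (\<kappa> * z x)"
        by (rule mult_left_mono) (simp add: a_def)
      then show "(-1) * (a x * \<phi> x (\<kappa> *\<^sub>R heat_deriv n \<theta> f x)) \<le> a x * (\<kappa> * z x)" by simp
    qed
    finally show ?thesis .
  qed
  \<comment> \<open>Young with \<epsilon> = 1/2, so that half of the left side can be
    absorbed.\<close>
  also have "\<dots> \<le> hcube_mean n (\<lambda>x. (1/2) * u x powr p + ((1/2) powr (1 - p) * \<kappa> powr p) * z x powr p)"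
  proof (intro hcube_mean_mono)
    fix x
    show "a x * (\<kappa> * z x) \<le> (1/2) * u x powr p + ((1/2) powr (1 - p) * \<kappa> powr p) * z x powr p"
      using powr_mult_le[OF u, of "\<kappa> * z x" "1/2" p x] \<kappa> p by (simp add: a_def z_def powr_mult mult.assoc)
  qed
  also have "\<dots> = (1/2) * ?U + ((1/2) powr (1 - p) * \<kappa> powr p) * hcube_mean n (\<lambda>x. z x powr p)"
    unfolding hcube_mean_add hcube_mean_cmult by (simp only: u_def)
  finally have "?U \<le> 2 * (1/2) powr (1 - p) * \<kappa> powr p * hcube_mean n (\<lambda>x. z x powr p)" by simp
  also have "2 * (1/2) powr (1 - p) = (2::real) powr p"
    by (simp add: powr_divide powr_diff)
  also have "2 powr p * \<kappa> powr p * hcube_mean n (\<lambda>x. z x powr p) \<le>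
    2 powr p * \<kappa> powr p * ((4 / t ^ K) powr p * (B * t powr p) * ?R)"
  proof (intro mult_left_mono)
    \<comment> \<open>The selector probability of the symmetrized scores; \<beta> \<le> 2 \<theta> =
      t^K turns \<open>\<beta> powr (p / K)\<close> into at most \<open>t powr p\<close>.\<close>
    define \<beta> where "\<beta> = 2 * \<theta> * (1 - \<theta>)"
    have \<beta>: "0 < \<beta>" "\<beta> \<le> 2 * \<theta>" using \<theta> by (auto simp: \<beta>_def mult_le_cancel_left2)
    have "hcube_mean n (\<lambda>x. z x powr p) \<le>
      hcube_mean n (\<lambda>x. flip_mean {1..n} \<theta> (\<lambda>s. norm (\<Sum>i=1..n. flip_score \<theta> (s i) *\<^sub>R hcube_deriv i f x) powr p))"
      unfolding z_def using \<theta> p by (intro heat_deriv_le) auto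
    also have "\<dots> \<le> hcube_mean n (\<lambda>x. ((4 / t ^ K) powr p * (B * t powr p)) *
      hcube_mean n (\<lambda>\<delta>. norm (\<Sum>i=1..n. \<delta> i *\<^sub>R hcube_deriv i f x) powr p))"
    proof (intro hcube_mean_mono)
      fix x
      let ?S = "hcube_mean n (\<lambda>\<delta>. norm (\<Sum>i=1..n. \<delta> i *\<^sub>R hcube_deriv i f x) powr p)"
      have S: "0 \<le> ?S" by (intro hcube_mean_nonneg) auto
      have "flip_mean {1..n} \<theta> (\<lambda>s. norm (\<Sum>i=1..n. flip_score \<theta> (s i) *\<^sub>R hcube_deriv i f x) powr p)
        \<le> (1 / (\<theta> * (1 - \<theta>))) powr p * wmean ({1..n} \<rightarrow>\<^sub>E {0, 1}) (prod_weight {1..n} (select_weight \<beta>))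
        (\<lambda>b. hcube_mean n (\<lambda>\<delta>. norm (\<Sum>i=1..n. \<delta> i *\<^sub>R b i *\<^sub>R hcube_deriv i f x) powr p))"
        unfolding \<beta>_def using \<theta> p by (intro flip_mean_score_le) auto
      also have "\<dots> \<le> (4 / t ^ K) powr p * (B * t powr p * ?S)"
      proof (intro mult_mono)
        have "\<theta> * (1 / 2) \<le> \<theta> * (1 - \<theta>)" using \<theta> by (intro mult_left_mono) auto
        then have "1 / (\<theta> * (1 - \<theta>)) \<le> 1 / (\<theta> * (1 / 2))" using \<theta> by (intro divide_left_mono) auto
        also have "\<dots> = 4 / t ^ K" by (simp add: \<theta>_def)
        finally show "(1 / (\<theta> * (1 - \<theta>))) powr p \<le> (4 / t ^ K) powr p"
          using \<theta> p by (intro powr_mono2) auto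
        have "\<beta> powr (p / K) \<le> (t ^ K) powr (p / K)"
          using \<beta> p by (intro powr_mono2) (auto simp: \<theta>_def)
        also have "\<dots> = t powr p" using t K by (simp add: powr_powr flip: powr_realpow)
        finally have \<beta>p: "\<beta> powr (p / K) \<le> t powr p" .
        have "wmean ({1..n} \<rightarrow>\<^sub>E {0, 1}) (prod_weight {1..n} (select_weight \<beta>))
          (\<lambda>b. hcube_mean n (\<lambda>\<delta>. norm (\<Sum>i=1..n. \<delta> i *\<^sub>R b i *\<^sub>R hcube_deriv i f x) powr p))
          \<le> B * \<beta> powr (p / K) * ?S"
          using \<beta> \<theta> by (intro sel) auto
        also have "\<dots> \<le> B * t powr p * ?S"
          using \<beta>p B S by (intro mult_right_mono mult_left_mono) auto
        finally show "wmean ({1..n} \<rightarrow>\<^sub>E {0, 1}) (prod_weight {1..n} (select_weight \<beta>))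
          (\<lambda>b. hcube_mean n (\<lambda>\<delta>. norm (\<Sum>i=1..n. \<delta> i *\<^sub>R b i *\<^sub>R hcube_deriv i f x) powr p))
          \<le> B * t powr p * ?S" .
        show "0 \<le> wmean ({1..n} \<rightarrow>\<^sub>E {0, 1}) (prod_weight {1..n} (select_weight \<beta>))
          (\<lambda>b. hcube_mean n (\<lambda>\<delta>. norm (\<Sum>i=1..n. \<delta> i *\<^sub>R b i *\<^sub>R hcube_deriv i f x) powr p))"
          using \<beta> \<theta> by (intro wmean_nonneg[OF prob_weight_select] hcube_mean_nonneg) auto
      qed auto
      finally show "flip_mean {1..n} \<theta> (\<lambda>s. norm (\<Sum>i=1..n. flip_score \<theta> (s i) *\<^sub>R hcube_deriv i f x) powr p)
        \<le> ((4 / t ^ K) powr p * (B * t powr p)) * ?S" by (simp add: mult.assoc)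
    qed
    finally show "hcube_mean n (\<lambda>x. z x powr p) \<le> (4 / t ^ K) powr p * (B * t powr p) * ?R"
      unfolding hcube_mean_cmult .
  qed auto
  also have "\<dots> = (2 * \<kappa> * (4 / t ^ K) * t) powr p * B * ?R"
  proof -
    define c where "c = 4 / t ^ K"
    have "0 < c" using t by (simp add: c_def)
    then show ?thesis using \<kappa> t by (simp add: powr_mult flip: c_def)
  qed
  \<comment> \<open>The powers of t cancel exactly, which is what \<theta> = t^K/2 was chosen
    for.\<close>
  also have "2 * \<kappa> * (4 / t ^ K) * t = 4 * real K"
    using t K by (cases K) (auto simp: \<kappa>_def)
  finally show ?thesis by simp
qed

lemma poincare_finite_cotype:
  assumes "finite_cotype TYPE('a::real_normed_vector)" "1 \<le> p"
  obtains C where "0 < C" "\<And>n (f :: (nat \<Rightarrow> real) \<Rightarrow> 'a).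
    hcube_mean n (\<lambda>x. norm (f x - hcube_mean n f) powr p)
    \<le> C * hcube_mean n (\<lambda>x. hcube_mean n (\<lambda>\<delta>. norm (\<Sum>i=1..n. \<delta> i *\<^sub>R hcube_deriv i f x) powr p))"
proof -
  obtain K :: nat and B :: real where KB: "0 < K" "0 < B"
    "\<And>n (v :: nat \<Rightarrow> 'a) \<beta>. 0 < \<beta> \<Longrightarrow> \<beta> \<le> 1 \<Longrightarrow>
      wmean ({1..n} \<rightarrow>\<^sub>E {0, 1}) (prod_weight {1..n} (select_weight \<beta>))
        (\<lambda>b. hcube_mean n (\<lambda>x. norm (\<Sum>i=1..n. x i *\<^sub>R b i *\<^sub>R v i) powr p))
      \<le> B * \<beta> powr (p / real K) * hcube_mean n (\<lambda>x. norm (\<Sum>i=1..n. x i *\<^sub>R v i) powr p)"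
    by (rule selector_finite_cotype[OF assms]) blast
  show thesis
  proof (rule that[of "(4 * real K) powr p * B"])
    show "0 < (4 * real K) powr p * B" using KB by simp
    show "hcube_mean n (\<lambda>x. norm (f x - hcube_mean n f) powr p)
      \<le> (4 * real K) powr p * B * hcube_mean n (\<lambda>x. hcube_mean n (\<lambda>\<delta>. norm (\<Sum>i=1..n. \<delta> i *\<^sub>R hcube_deriv i f x) powr p))"
      for n and f :: "(nat \<Rightarrow> real) \<Rightarrow> 'a"
      by (rule poincare_of_selector[OF assms(2) KB(1,2)]) (rule KB(3))
  qed
qed

subsection \<open>A one-sided Bobkov inequality\<close>

text \<open>Of the order of the Gaussian isoperimetric profile for small t, but not symmetric: its
  value 1 at t = 1 puts a bounded term on the whole level set, harmless because the mean on the
  other side gains the logarithm.\<close>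

definition iso_profile :: "real \<Rightarrow> real" where
  "iso_profile t = t * sqrt (1 - ln t)"

lemma iso_profile_nonneg: "0 \<le> t \<Longrightarrow> t \<le> 1 \<Longrightarrow> 0 \<le> iso_profile t"
  using ln_le_minus_one[of t] by (cases "t = 0") (auto simp: iso_profile_def)

lemma iso_profile_square: "0 < t \<Longrightarrow> t \<le> 1 \<Longrightarrow> (iso_profile t)\<^sup>2 = t\<^sup>2 * (1 - ln t)"
  using ln_le_minus_one[of t] by (simp add: iso_profile_def power_mult_distrib)

lemma iso_profile_le_1:
  assumes "0 \<le> t" "t \<le> 1" shows "iso_profile t \<le> 1"
proof (cases "t = 0")
  case False
  then have t: "0 < t" using assms by simp
  have "- ln t \<le> 1 / t - 1" using ln_le_minus_one[of "1 / t"] t by (simp add: ln_div)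
  then have "t\<^sup>2 * (1 - ln t) \<le> t\<^sup>2 * (1 / t)" by (intro mult_left_mono) auto
  also have "\<dots> \<le> 1" using t assms by (simp add: power2_eq_square)
  finally have "(iso_profile t)\<^sup>2 \<le> 1\<^sup>2" using iso_profile_square[OF t assms(2)] by simp
  then show ?thesis by (rule power2_le_imp_le) simp
qed (simp add: iso_profile_def)

text \<open>Square and expand around the midpoint s with a = s + d, b = s - d. The terms in L match
  because 2 s - b = a; the rest is at most 6 d^2, within the allowed 2 (a - b)^2 = 8 d^2. The
  degenerate case b = 0 needs only ln 2 \<le> 2.\<close>

lemma two_point_iso_profile:
  assumes ab: "0 \<le> b" "b \<le> a" "a \<le> 1"
  shows "2 * iso_profile ((a + b) / 2) - iso_profile b \<le> sqrt ((iso_profile a)\<^sup>2 + 2 * (a - b)\<^sup>2)"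
proof (cases "b = 0")
  case b0: True
  show ?thesis
  proof (cases "a = 0")
    case False
    then have a: "0 < a" using ab by simp
    have "(2 * iso_profile (a / 2))\<^sup>2 = a\<^sup>2 * (1 - ln a + ln 2)"
      using iso_profile_square[of "a / 2"] a ab by (simp add: power_mult_distrib ln_div power_divide mult.commute)
    also have "\<dots> \<le> a\<^sup>2 * (1 - ln a) + 2 * a\<^sup>2"
    proof -
      have "a\<^sup>2 * ln 2 \<le> a\<^sup>2 * 2" using ln_2_less_1 by (intro mult_left_mono) auto
      then show ?thesis by (simp add: algebra_simps)
    qed
    also have "a\<^sup>2 * (1 - ln a) = (iso_profile a)\<^sup>2" using iso_profile_square[of a] a ab by simp
    finally show ?thesis unfolding b0 by (intro real_le_rsqrt) (simp add: iso_profile_def)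
  qed (simp add: b0 iso_profile_def)
next
  case False
  then have b: "0 < b" using ab by simp
  define s d where "s = (a + b) / 2" and "d = (a - b) / 2"
  have a_eq: "a = s + d" and b_eq: "b = s - d" by (auto simp: s_def d_def field_simps)
  have s: "0 < s" "s \<le> 1" and d: "0 \<le> d" and bs: "b \<le> s" and a2: "a \<le> 2 * s"
    using ab b by (auto simp: s_def d_def)
  define L w v where "L = 1 - ln s" and "w = ln (s / b)" and "v = ln (a / s)"
  have L: "1 \<le> L" using s by (simp add: L_def)
  have w0: "0 \<le> w" using b bs by (simp add: w_def)
  have Jb: "(iso_profile b)\<^sup>2 = b\<^sup>2 * (L + w)"
    using iso_profile_square[OF b] ab b s by (simp add: L_def w_def ln_div)
  have Ja: "(iso_profile a)\<^sup>2 = a\<^sup>2 * (L - v)"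
    using iso_profile_square[of a] ab b s by (simp add: L_def v_def ln_div)
  have Js: "(iso_profile s)\<^sup>2 = s\<^sup>2 * L"
    using iso_profile_square[of s] s by (simp add: L_def)
  define y where "y = sqrt L * sqrt (L + w)"
  have JsJb: "iso_profile s * iso_profile b = s * b * y"
    using b s by (simp add: iso_profile_def y_def L_def w_def ln_div)
  \<comment> \<open>The second-order Taylor bound for sqrt (L (L + w)); L \<ge> 1 replaces 8 L by 8
    in the last term.\<close>
  have y: "L + w / 2 - w\<^sup>2 / 8 \<le> y"
  proof (rule ccontr)
    assume "\<not> ?thesis"
    then have lt: "w\<^sup>2 / 8 < L + w / 2 - y" by simp
    have "sqrt L * sqrt L \<le> y" unfolding y_def using w0 L by (intro mult_left_mono) auto
    then have "L \<le> y" using L by simp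
    then have ge: "2 \<le> L + w / 2 + y" using L w0 by simp
    have "(L + w / 2 - y) * (L + w / 2 + y) = (L + w / 2)\<^sup>2 - y\<^sup>2"
      by (simp add: power2_eq_square algebra_simps)
    also have "y\<^sup>2 = L * (L + w)" using L w0 by (simp add: y_def power_mult_distrib)
    also have "(L + w / 2)\<^sup>2 - L * (L + w) = w\<^sup>2 / 4" by (simp add: power2_eq_square field_simps)
    finally have eq: "(L + w / 2 - y) * (L + w / 2 + y) = w\<^sup>2 / 4" .
    have "w\<^sup>2 / 4 < (L + w / 2 - y) * 2" using lt by simp
    also have "\<dots> \<le> (L + w / 2 - y) * (L + w / 2 + y)"
    proof (intro mult_left_mono ge)
      show "0 \<le> L + w / 2 - y" using lt zero_le_power2[of w] by linarith
    qed
    also note eq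
    finally show False by simp
  qed
  have v: "v \<le> d / s"
  proof -
    have "a / s - 1 = d / s" using s by (simp add: a_eq field_simps)
    then show ?thesis using ln_le_minus_one[of "a / s"] s ab b by (simp add: v_def)
  qed
  have w: "d / s \<le> w"
  proof -
    have "b / s - 1 = - (d / s)" using s by (simp add: b_eq field_simps)
    moreover have "w = - ln (b / s)" using s b by (simp add: w_def ln_div)
    ultimately show ?thesis using ln_le_minus_one[of "b / s"] s b by simp
  qed
  have sbw: "s * b * w\<^sup>2 \<le> 4 * d\<^sup>2"
  proof -
    \<comment> \<open>Halving the logarithm matters: ln z \<le> z - 1 at z = s/b would give s (s -
      b)^2 / b, unbounded as b tends to 0.\<close>
    define q where "q = sqrt (s / b)"
    have q: "1 \<le> q" using b bs by (simp add: q_def)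
    have s_eq: "s = b * q\<^sup>2" using b s by (simp add: q_def)
    have "w = 2 * ln q" using b s by (simp add: w_def q_def ln_sqrt)
    also have "\<dots> \<le> 2 * (q - 1)" using ln_le_minus_one[of q] q by simp
    finally have "w\<^sup>2 \<le> (2 * (q - 1))\<^sup>2" using w0 by (intro power_mono) auto
    then have "s * b * w\<^sup>2 \<le> s * b * (2 * (q - 1))\<^sup>2" using b s by (intro mult_left_mono) auto
    also have "\<dots> = (2 * b * (q - 1) * q)\<^sup>2" unfolding s_eq by (simp add: power2_eq_square mult_ac)
    also have "\<dots> \<le> (2 * b * (q - 1) * (q + 1))\<^sup>2" using b q by (intro power_mono mult_left_mono) auto
    also have "2 * b * (q - 1) * (q + 1) = 2 * d"
      using s_eq unfolding b_eq by (simp add: power2_eq_square algebra_simps)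
    finally show ?thesis by (simp add: power_mult_distrib)
  qed
  have "(2 * iso_profile s - iso_profile b)\<^sup>2
    = 4 * (iso_profile s)\<^sup>2 - 4 * (iso_profile s * iso_profile b) + (iso_profile b)\<^sup>2"
    by (simp add: power2_eq_square algebra_simps)
  also have "\<dots> = 4 * (s\<^sup>2 * L) - 4 * (s * b * y) + b\<^sup>2 * (L + w)"
    unfolding Js Jb JsJb ..
  also have "\<dots> \<le> 4 * (s\<^sup>2 * L) - 4 * (s * b * (L + w / 2 - w\<^sup>2 / 8)) + b\<^sup>2 * (L + w)"
    using mult_left_mono[OF y, of "s * b"] s b by simp
  also have "\<dots> = a\<^sup>2 * L - a * b * w + (s * b * w\<^sup>2) / 2"
    unfolding a_eq b_eq by (simp add: power2_eq_square field_simps)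
  also have "\<dots> \<le> a\<^sup>2 * L - a * b * (d / s) + 2 * d\<^sup>2"
    using mult_left_mono[OF w, of "a * b"] ab b sbw by simp
  also have "\<dots> = a\<^sup>2 * (L - d / s) + a * (a - b) * d / s + 2 * d\<^sup>2"
    by (simp add: power2_eq_square algebra_simps diff_divide_distrib)
  also have "\<dots> \<le> a\<^sup>2 * (L - v) + 4 * d\<^sup>2 + 2 * d\<^sup>2"
  proof (intro add_mono mult_left_mono)
    have "a * (a - b) * d / s = (a / s) * (2 * d\<^sup>2)" unfolding a_eq b_eq by (simp add: power2_eq_square)
    also have "\<dots> \<le> 2 * (2 * d\<^sup>2)" using a2 s by (intro mult_right_mono) (auto simp: divide_le_eq)
    finally show "a * (a - b) * d / s \<le> 4 * d\<^sup>2" by simp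
  qed (use v in auto)
  also have "\<dots> \<le> (iso_profile a)\<^sup>2 + 2 * (a - b)\<^sup>2"
    unfolding Ja by (simp add: a_eq b_eq power2_eq_square)
  finally show ?thesis unfolding s_def by (rule real_le_rsqrt)
qed

text \<open>Induction on the dimension. On each face the term of the last edge is carried through
  the mean by \<open>sqrt_hcube_mean_le\<close>, and the two face means are then compared by the
  two-point inequality.\<close>

lemma bobkov_one_sided:
  assumes "\<And>x. 0 \<le> h x" "\<And>x. h x \<le> 1"
  shows "iso_profile (hcube_mean n h) \<le> hcube_mean n (\<lambda>x. sqrt ((iso_profile (h x))\<^sup>2 + 2 * upgrad2 n h x))"
  using assms
proof (induction n arbitrary: h)
  case 0
  then show ?case by (simp add: hcube_mean_0 upgrad2_def)
next
  case (Suc n)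
  define \<Phi> where "\<Phi> f g = hcube_mean n (\<lambda>x. sqrt ((iso_profile (f x))\<^sup>2 + 2 * (upgrad2 n f x + (max 0 (f x - g x))\<^sup>2)))"
    for f g :: "(nat \<Rightarrow> real) \<Rightarrow> real"
  have step: "sqrt ((iso_profile (hcube_mean n f))\<^sup>2 + 2 * (max 0 (hcube_mean n f - hcube_mean n g))\<^sup>2) \<le> \<Phi> f g"
    if f: "\<And>x. 0 \<le> f x" "\<And>x. f x \<le> 1" for f g :: "(nat \<Rightarrow> real) \<Rightarrow> real"
  proof -
    define F where "F = (\<lambda>x. sqrt ((iso_profile (f x))\<^sup>2 + 2 * upgrad2 n f x))"
    define G where "G = (\<lambda>x. sqrt 2 * max 0 (f x - g x))"
    have "0 \<le> hcube_mean n f" "hcube_mean n f \<le> 1"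
      using hcube_mean_nonneg[of n f] hcube_mean_mono[of n f "\<lambda>_. 1"] f by (auto simp: hcube_mean_const)
    then have "0 \<le> iso_profile (hcube_mean n f)" by (rule iso_profile_nonneg)
    moreover have "iso_profile (hcube_mean n f) \<le> hcube_mean n F"
      unfolding F_def by (rule Suc.IH[OF f])
    ultimately have 1: "(iso_profile (hcube_mean n f))\<^sup>2 \<le> (hcube_mean n F)\<^sup>2"
      by (intro power_mono)
    have "hcube_mean n f - hcube_mean n g \<le> hcube_mean n (\<lambda>x. max 0 (f x - g x))"
      unfolding hcube_mean_diff[symmetric] by (intro hcube_mean_mono) simp
    moreover have "0 \<le> hcube_mean n (\<lambda>x. max 0 (f x - g x))"
      by (intro hcube_mean_nonneg) simp
    ultimately have "(max 0 (hcube_mean n f - hcube_mean n g))\<^sup>2 \<le> (hcube_mean n (\<lambda>x. max 0 (f x - g x)))\<^sup>2"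
      by (intro power_mono) auto
    then have 2: "2 * (max 0 (hcube_mean n f - hcube_mean n g))\<^sup>2 \<le> (hcube_mean n G)\<^sup>2"
      unfolding G_def hcube_mean_cmult by (simp add: power_mult_distrib)
    have "sqrt ((iso_profile (hcube_mean n f))\<^sup>2 + 2 * (max 0 (hcube_mean n f - hcube_mean n g))\<^sup>2)
      \<le> sqrt ((hcube_mean n F)\<^sup>2 + (hcube_mean n G)\<^sup>2)"
      using 1 2 by simp
    also have "\<dots> \<le> hcube_mean n (\<lambda>x. sqrt ((F x)\<^sup>2 + (G x)\<^sup>2))"
      by (rule sqrt_hcube_mean_le)
    also have "\<dots> = \<Phi> f g"
      unfolding \<Phi>_def F_def G_def
      by (simp add: upgrad2_nonneg power_mult_distrib algebra_simps)
    finally show ?thesis .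
  qed
  have two: "2 * iso_profile ((hcube_mean n f + hcube_mean n g) / 2) \<le> \<Phi> f g + \<Phi> g f"
    if f: "\<And>x. 0 \<le> f x" "\<And>x. f x \<le> 1" and g: "\<And>x. 0 \<le> g x" "\<And>x. g x \<le> 1"
      and le: "hcube_mean n g \<le> hcube_mean n f" for f g :: "(nat \<Rightarrow> real) \<Rightarrow> real"
  proof -
    have "0 \<le> hcube_mean n g" "hcube_mean n f \<le> 1" "hcube_mean n g \<le> 1"
      using hcube_mean_nonneg[of n g] hcube_mean_mono[of n f "\<lambda>_. 1"] hcube_mean_mono[of n g "\<lambda>_. 1"] f g
      by (auto simp: hcube_mean_const)
    then have "2 * iso_profile ((hcube_mean n f + hcube_mean n g) / 2) - iso_profile (hcube_mean n g)
      \<le> sqrt ((iso_profile (hcube_mean n f))\<^sup>2 + 2 * (hcube_mean n f - hcube_mean n g)\<^sup>2)"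
      and "0 \<le> iso_profile (hcube_mean n g)"
      using le by (auto intro!: two_point_iso_profile iso_profile_nonneg)
    \<comment> \<open>The last edge is charged to the face with the larger mean; the other face
      contributes its bare profile, the term subtracted in
      \<open>two_point_iso_profile\<close>.\<close>
    moreover have "max 0 (hcube_mean n f - hcube_mean n g) = hcube_mean n f - hcube_mean n g"
      "max 0 (hcube_mean n g - hcube_mean n f) = 0"
      using le by auto
    ultimately show ?thesis
      using step[of f g, OF f] step[of g f, OF g] by simp
  qed
  define f g where "f = (\<lambda>x. h (x(Suc n := 1)))" and "g = (\<lambda>x. h (x(Suc n := -1)))"
  have fg: "\<And>x. 0 \<le> f x" "\<And>x. f x \<le> 1" "\<And>x. 0 \<le> g x" "\<And>x. g x \<le> 1"
    using Suc.prems by (auto simp: f_def g_def)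
  have "2 * iso_profile ((hcube_mean n f + hcube_mean n g) / 2) \<le> \<Phi> f g + \<Phi> g f"
    using two[of f g] two[of g f] fg by (cases "hcube_mean n g \<le> hcube_mean n f") (auto simp: add.commute)
  then show ?case
    unfolding hcube_mean_Suc[of n] upgrad2_Suc by (simp add: \<Phi>_def f_def g_def)
qed

subsection \<open>From the isoperimetric profile to the Orlicz norm\<close>

definition clip :: "real \<Rightarrow> real \<Rightarrow> real" where
  "clip c t = min (max (t / c - 1) 0) 1"

lemma clip_bounds: "0 \<le> clip c t" "clip c t \<le> 1"
  by (auto simp: clip_def)

lemma clip_eq_0: "0 < c \<Longrightarrow> t \<le> c \<Longrightarrow> clip c t = 0"
  by (simp add: clip_def divide_le_eq)

lemma clip_eq_1: "0 < c \<Longrightarrow> 2 * c \<le> t \<Longrightarrow> clip c t = 1"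
  by (simp add: clip_def le_divide_eq)

text \<open>The slope 1/c is traded for 2/a, a being the larger value. An edge may jump over many
  levels, so a may lie far above 2 c; with 1/c there, the sum over levels would lose a logarithm at
  p = 1.\<close>

lemma clip_diff_le:
  assumes "0 < c" "c < a" "0 \<le> b"
  shows "max 0 (clip c a - clip c b) \<le> 2 / a * max 0 (a - b)"
proof (cases "b < a")
  case False
  then have "clip c a \<le> clip c b"
    using assms unfolding clip_def by (intro min.mono max.mono) (auto simp: divide_right_mono)
  then show ?thesis using False by simp
next
  case True
  have main: "clip c a - clip c b \<le> 2 / a * (a - b)"
  proof (cases "2 * c \<le> b")
    case True
    then show ?thesis using \<open>b < a\<close> assms by (simp add: clip_eq_1)
  next
    case False
    then have b: "b / c - 1 \<le> clip c b" using assms by (simp add: clip_def divide_le_eq)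
    show ?thesis
    proof (cases "a \<le> 2 * c")
      case True
      have "clip c a - clip c b \<le> (a - b) / c"
        using b assms True by (simp add: clip_def diff_divide_distrib divide_le_eq)
      also have "\<dots> \<le> (a - b) / (a / 2)"
        using True \<open>b < a\<close> assms by (intro divide_left_mono) auto
      also have "\<dots> = 2 / a * (a - b)" using assms by (simp add: field_simps)
      finally show ?thesis .
    next
      case a: False
      have "clip c a - clip c b \<le> 2 - b / c" using b clip_bounds(2)[of c a] by simp
      also have "b * 2 / a \<le> b / c"
      proof -
        have "b / (a / 2) \<le> b / c" using a assms by (intro divide_left_mono) auto
        then show ?thesis by simp
      qed
      then have "2 - b / c \<le> 2 / a * (a - b)" using assms by (simp add: diff_divide_distrib right_diff_distrib mult.commute)
      finally show ?thesis .
    qed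
  qed
  have "max 0 (a - b) = a - b" "0 \<le> 2 / a * (a - b)" using True assms by auto
  then show ?thesis using main by (metis max.boundedI)
qed

lemma upgrad2_clip_le:
  assumes G: "\<And>x. 0 \<le> G x" and c: "0 < c"
  shows "sqrt ((iso_profile (clip c (G x)))\<^sup>2 + 2 * upgrad2 n (\<lambda>x. clip c (G x)) x)
    \<le> (if c < G x then 1 + 3 * (sqrt (upgrad2 n G x) / G x) else 0)"
proof (cases "c < G x")
  case False
  then have "max 0 (clip c (G x) - clip c t) = 0" for t
    using clip_bounds(1)[of c t] c by (simp add: clip_eq_0)
  then have "upgrad2 n (\<lambda>x. clip c (G x)) x = 0" by (simp add: upgrad2_def)
  then show ?thesis using False c by (simp add: clip_eq_0 iso_profile_def)
next
  case True
  have "upgrad2 n (\<lambda>x. clip c (G x)) x \<le> (\<Sum>i=1..n. (2 / G x * max 0 (G x - G (x(i := - x i))))\<^sup>2)"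
    unfolding upgrad2_def using clip_diff_le[OF c True G] by (intro sum_mono power_mono) auto
  also have "\<dots> = (2 / G x)\<^sup>2 * upgrad2 n G x"
    unfolding upgrad2_def sum_distrib_left power_mult_distrib ..
  finally have up: "upgrad2 n (\<lambda>x. clip c (G x)) x \<le> (2 / G x)\<^sup>2 * upgrad2 n G x" .
  have "sqrt ((iso_profile (clip c (G x)))\<^sup>2 + 2 * upgrad2 n (\<lambda>x. clip c (G x)) x)
    \<le> sqrt ((iso_profile (clip c (G x)))\<^sup>2) + sqrt (2 * upgrad2 n (\<lambda>x. clip c (G x)) x)"
    by (rule sqrt_add_le_add_sqrt) (auto simp: upgrad2_nonneg)
  also have "sqrt ((iso_profile (clip c (G x)))\<^sup>2) \<le> 1"
    using iso_profile_le_1[OF clip_bounds] iso_profile_nonneg[OF clip_bounds] by simp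
  \<comment> \<open>2 times 2^2 is 8, rounded up to 9 for a rational root.\<close>
  also have "sqrt (2 * upgrad2 n (\<lambda>x. clip c (G x)) x) \<le> sqrt ((3 / G x)\<^sup>2 * upgrad2 n G x)"
  proof (intro real_sqrt_le_mono)
    have "2 * upgrad2 n (\<lambda>x. clip c (G x)) x \<le> (8 / (G x)\<^sup>2) * upgrad2 n G x"
      using up by (simp add: power_divide)
    also have "\<dots> \<le> (9 / (G x)\<^sup>2) * upgrad2 n G x"
      by (intro mult_right_mono divide_right_mono) (auto simp: upgrad2_nonneg)
    finally show "2 * upgrad2 n (\<lambda>x. clip c (G x)) x \<le> (3 / G x)\<^sup>2 * upgrad2 n G x"
      by (simp add: power_divide)
  qed
  also have "\<dots> = 3 * (sqrt (upgrad2 n G x) / G x)"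
    using G[of x] by (simp add: real_sqrt_mult)
  finally show ?thesis using True by simp
qed

lemma ln2_ge_half: "1 / 2 \<le> ln (2::real)"
  using ln_le_minus_one[of "1/2::real"] by (simp add: ln_div)

text \<open>The source of the logarithm. The truncation vanishes below 2^k, so Markov gives m \<le>
  2^(-k), and sqrt (1 - ln m) is at least sqrt (k + 1) / 2.\<close>

lemma level_inequality:
  assumes G: "\<And>x. 0 \<le> G x" and p: "1 \<le> p" and Gp: "hcube_mean n (\<lambda>x. G x powr p) \<le> 1"
  shows "sqrt (real (Suc k)) * hcube_mean n (\<lambda>x. clip (2 ^ k) (G x))
    \<le> 2 * hcube_mean n (\<lambda>x. if 2 ^ k < G x then 1 + 3 * (sqrt (upgrad2 n G x) / G x) else 0)"
    (is "_ \<le> 2 * ?E")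
proof -
  define m where "m = hcube_mean n (\<lambda>x. clip (2 ^ k) (G x))"
  have E: "iso_profile m \<le> ?E"
  proof -
    have "iso_profile m \<le> hcube_mean n (\<lambda>x. sqrt ((iso_profile (clip (2 ^ k) (G x)))\<^sup>2 + 2 * upgrad2 n (\<lambda>x. clip (2 ^ k) (G x)) x))"
      unfolding m_def by (rule bobkov_one_sided) (auto simp: clip_bounds)
    also have "\<dots> \<le> ?E" by (intro hcube_mean_mono upgrad2_clip_le G) simp
    finally show ?thesis .
  qed
  have m0: "0 \<le> m" unfolding m_def by (intro hcube_mean_nonneg clip_bounds)
  show ?thesis
  proof (cases "m = 0")
    case True
    then show ?thesis using E by (simp add: iso_profile_def flip: m_def)
  next
    case False
    with m0 have m: "0 < m" by simp
    have "m \<le> hcube_mean n (\<lambda>x. (1 / 2 ^ k) * G x powr p)"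
      unfolding m_def
    proof (intro hcube_mean_mono)
      fix x
      show "clip (2 ^ k) (G x) \<le> (1 / 2 ^ k) * G x powr p"
      proof (cases "G x \<le> 2 ^ k")
        case True
        then show ?thesis by (simp add: clip_eq_0)
      next
        case False
        have "1 \<le> (2::real) ^ k" by simp
        then have "1 \<le> G x" using False by linarith
        then have "G x powr 1 \<le> G x powr p" using p by (intro powr_mono) auto
        then have "2 ^ k \<le> G x powr p" using False \<open>1 \<le> G x\<close> by simp
        then have "1 \<le> (1 / 2 ^ k) * G x powr p" by (simp add: field_simps)
        then show ?thesis using clip_bounds(2)[of "2 ^ k" "G x"] by linarith
      qed
    qed
    also have "\<dots> \<le> (1 / 2 ^ k) * 1"
      unfolding hcube_mean_cmult using Gp by (intro mult_left_mono) auto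
    finally have "ln m \<le> ln (1 / 2 ^ k)" using m by (subst ln_le_cancel_iff) auto
    also have "\<dots> = - (real k * ln 2)" by (simp add: ln_div ln_realpow)
    also have "\<dots> \<le> - (real k * (1 / 2))" using ln2_ge_half by (simp only: neg_le_iff_le) (intro mult_left_mono, auto)
    finally have "real (Suc k) \<le> 4 * (1 - ln m)" by simp
    then have "sqrt (real (Suc k)) \<le> sqrt (4 * (1 - ln m))" by (rule real_sqrt_le_mono)
    also have "\<dots> = 2 * sqrt (1 - ln m)" by (subst real_sqrt_mult) simp
    finally have "sqrt (real (Suc k)) * m \<le> 2 * iso_profile m"
      using m by (simp add: iso_profile_def mult.commute mult.left_commute)
    then show ?thesis using E by (simp add: m_def)
  qed
qed

lemma dyadic_level:
  assumes "1 < (t::real)"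
  obtains k :: nat where "2 ^ k < t" "t \<le> 2 ^ Suc k"
proof -
  obtain m :: nat where "t < 2 ^ m" using real_arch_pow[of 2 t] by auto
  then have "\<exists>m::nat. t \<le> 2 ^ m" by (auto intro: less_imp_le)
  moreover have "\<not> t \<le> 2 ^ 0" using assms by simp
  ultimately obtain k where "\<not> t \<le> 2 ^ k" "t \<le> 2 ^ Suc k"
    using exists_least_lemma[of "\<lambda>m. t \<le> 2 ^ m"] by blast
  then show thesis using that[of k] by (simp add: not_le)
qed

lemma powr_add_le:
  fixes x y :: real
  assumes "0 \<le> x" "0 \<le> y" "0 \<le> p"
  shows "(x + y) powr p \<le> 2 powr p * (x powr p + y powr p)"
proof -
  have "(x + y) powr p \<le> (2 * max x y) powr p" using assms by (intro powr_mono2) auto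
  also have "\<dots> = 2 powr p * (max x y) powr p" using assms by (simp add: powr_mult)
  also have "\<dots> \<le> 2 powr p * (x powr p + y powr p)"
    by (intro mult_left_mono) (auto simp: max_def)
  finally show ?thesis .
qed

text \<open>
  The weight \<open>(2\<^sup>k \<surd>(k+1))\<^sup>p\<close> is comparable to the Young function at the level \<open>2\<^sup>k < t \<le> 2\<^bsup>k+1\<^esup>\<close>.
\<close>

definition level_weight :: "real \<Rightarrow> nat \<Rightarrow> real" where
  "level_weight p k = (2 ^ k * sqrt (real (Suc k))) powr p"

lemma LlogL_fun_le_level_weight:
  assumes t: "0 \<le> t" "t \<le> 2 ^ Suc k" and p: "1 \<le> p"
  shows "LlogL_fun p (p/2) t \<le> 2 powr p * (2 + p) powr (p/2) * level_weight p k"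
proof -
  define z where "z = (2::real) ^ k"
  have z: "1 \<le> z" by (simp add: z_def)
  have tp: "t powr p \<le> 2 powr p * z powr p"
  proof -
    have "t powr p \<le> (2 * z) powr p" using t p by (intro powr_mono2) (auto simp: z_def)
    then show ?thesis using z by (simp add: powr_mult)
  qed
  have "1 \<le> 2 powr p * z powr p"
    using p z ge_one_powr_ge_zero[of 2 p] ge_one_powr_ge_zero[of z p] by (intro mult_ge1_I) auto
  moreover have "t powr p \<le> exp 1 * (2 powr p * z powr p)"
  proof -
    have "t powr p \<le> 1 * (2 powr p * z powr p)" using tp by simp
    also have "\<dots> \<le> exp 1 * (2 powr p * z powr p)" by (intro mult_right_mono) auto
    finally show ?thesis .
  qed
  moreover have "exp 1 * 1 \<le> exp (1::real) * (2 powr p * z powr p)"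
    using \<open>1 \<le> 2 powr p * z powr p\<close> by (intro mult_left_mono) auto
  ultimately have "exp 1 + t powr p \<le> 2 * (exp 1 * (2 powr p * z powr p))" by linarith
  moreover have "0 < exp 1 + t powr p" by (simp add: add_pos_nonneg)
  ultimately have "ln (exp 1 + t powr p) \<le> ln (2 * (exp 1 * (2 powr p * z powr p)))"
    by (subst ln_le_cancel_iff) (auto intro: less_le_trans)
  also have "\<dots> = ln 2 + (1 + (p * ln 2 + p * (real k * ln 2)))"
    using z by (simp add: ln_mult ln_powr) (simp add: z_def ln_realpow)
  also have "\<dots> \<le> 1 + (1 + (p * 1 + p * (real k * 1)))"
    using ln_2_less_1 p by (intro add_mono mult_left_mono) auto
  also have "\<dots> \<le> (2 + p) * real (Suc k)" by (simp add: algebra_simps)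
  finally have "ln (exp 1 + t powr p) \<le> (2 + p) * real (Suc k)" .
  moreover have "0 \<le> ln (exp 1 + t powr p)"
    by (intro ln_ge_zero) (use one_le_exp_iff[of 1] in \<open>simp add: add_increasing2\<close>)
  ultimately have "ln (exp 1 + t powr p) powr (p/2) \<le> ((2 + p) * real (Suc k)) powr (p/2)"
    using p by (intro powr_mono2) auto
  also have "\<dots> = (2 + p) powr (p/2) * sqrt (real (Suc k)) powr p"
    using p by (simp add: powr_mult powr_powr flip: powr_half_sqrt)
  finally have "LlogL_fun p (p/2) t \<le> (2 powr p * z powr p) * ((2 + p) powr (p/2) * sqrt (real (Suc k)) powr p)"
    unfolding LlogL_fun_def using tp by (intro mult_mono) auto
  then show ?thesis using z by (simp add: level_weight_def powr_mult mult_ac flip: z_def)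
qed

text \<open>2 sqrt ((k + 2)/(k + 1)) is at most 2 sqrt 2, which is below 3.\<close>

lemma level_weight_Suc_le:
  assumes "1 \<le> p" shows "level_weight p (Suc k) \<le> 3 powr p * level_weight p k"
proof -
  have "(2 * sqrt (real (Suc (Suc k))))\<^sup>2 \<le> (3 * sqrt (real (Suc k)))\<^sup>2"
    by (simp add: power_mult_distrib)
  then have "2 * sqrt (real (Suc (Suc k))) \<le> 3 * sqrt (real (Suc k))"
    by (rule power2_le_imp_le) simp
  then have "level_weight p (Suc k) \<le> (2 ^ k * (3 * sqrt (real (Suc k)))) powr p"
    unfolding level_weight_def using assms by (intro powr_mono2) auto
  also have "\<dots> = 3 powr p * level_weight p k"
    by (simp add: level_weight_def powr_mult mult_ac)
  finally show ?thesis .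
qed

text \<open>\<open>level_weight p k\<close> without the factor sqrt (k + 1) that
  \<open>level_inequality\<close> supplies; the power p - 1 is kept apart for
  \<open>powr_mult_le\<close>.\<close>

definition level_coeff :: "real \<Rightarrow> nat \<Rightarrow> real" where
  "level_coeff p k = (2 ^ k * sqrt (real (Suc k))) powr (p - 1) * 2 ^ k"

lemma level_coeff_mult: "level_coeff p k * sqrt (real (Suc k)) = level_weight p k"
  using powr_mult_base[of "2 ^ k * sqrt (real (Suc k))" "p - 1"]
  by (simp add: level_coeff_def level_weight_def mult_ac)

text \<open>The factor 2^k makes the coefficients at least double from level to level, even for p =
  1, so the last one dominates.\<close>

lemma sum_level_coeff_le:
  assumes "1 \<le> p" shows "(\<Sum>k\<le>m. level_coeff p k) \<le> 2 * level_coeff p m"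
proof (induction m)
  case 0
  then show ?case by (simp add: level_coeff_def)
next
  case (Suc m)
  have "(2 ^ m * sqrt (real (Suc m))) powr (p - 1) \<le> (2 ^ Suc m * sqrt (real (Suc (Suc m)))) powr (p - 1)"
    using assms by (intro powr_mono2 mult_mono) auto
  then have "2 * level_coeff p m \<le> level_coeff p (Suc m)"
    unfolding level_coeff_def by simp
  then show ?case using Suc by simp
qed

text \<open>A bootstrap in the mean: the weight A of the level of G is bounded by the truncation sum
  W, W by the gradient sum V through \<open>level_inequality\<close>, and V by a small multiple of A
  plus L_p terms.\<close>

lemma scalar_LlogL:
  assumes p: "1 \<le> p"
  obtains C where "0 < C" "\<And>n G. (\<And>x. 0 \<le> G x) \<Longrightarrow> hcube_mean n (\<lambda>x. G x powr p) \<le> 1 \<Longrightarrow>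
    hcube_mean n (\<lambda>x. sqrt (upgrad2 n G x) powr p) \<le> 1 \<Longrightarrow>
    hcube_mean n (\<lambda>x. LlogL_fun p (p/2) (G x)) \<le> C"
proof -
  \<comment> \<open>Chosen so that the mean of A returns with total coefficient 1/4.\<close>
  define \<epsilon> where "\<epsilon> = 1 / (16 * 3 powr p)"
  have \<epsilon>: "0 < \<epsilon>" by (simp add: \<epsilon>_def)
  define A0 where "A0 = 2 + 16 * 3 powr p * \<epsilon> powr (1 - p) * (2 powr p * (1 + 3 powr p))"
  define C where "C = 2 powr p * (2 + p) powr (p/2) * (1 + A0)"
  have A0: "0 < A0" by (simp add: A0_def add_pos_nonneg)
  have "hcube_mean n (\<lambda>x. LlogL_fun p (p/2) (G x)) \<le> C"
    if G: "\<And>x. 0 \<le> G x" and Gp: "hcube_mean n (\<lambda>x. G x powr p) \<le> 1"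
      and Mp: "hcube_mean n (\<lambda>x. sqrt (upgrad2 n G x) powr p) \<le> 1" for n G
  proof -
    define M where "M x = sqrt (upgrad2 n G x)" for x
    have M: "0 \<le> M x" for x by (simp add: M_def upgrad2_nonneg)
    have "\<exists>k::nat. 1 < G x \<longrightarrow> 2 ^ k < G x \<and> G x \<le> 2 ^ Suc k" for x
    proof (cases "1 < G x")
      case True
      then show ?thesis by (rule dyadic_level) blast
    qed simp
    then have "\<exists>\<kappa> :: _ \<Rightarrow> nat. \<forall>x. 1 < G x \<longrightarrow> 2 ^ \<kappa> x < G x \<and> G x \<le> 2 ^ Suc (\<kappa> x)"
      by (intro choice allI)
    then obtain \<kappa> :: "_ \<Rightarrow> nat" where \<kappa>: "\<And>x. 1 < G x \<Longrightarrow> 2 ^ \<kappa> x < G x" "\<And>x. 1 < G x \<Longrightarrow> G x \<le> 2 ^ Suc (\<kappa> x)"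
      by blast
    have \<kappa>_iff: "2 ^ k < G x \<longleftrightarrow> k \<le> \<kappa> x" if "1 < G x" for k x
    proof
      assume "2 ^ k < G x"
      then have "(2::real) ^ k < 2 ^ Suc (\<kappa> x)" using \<kappa>(2)[OF that] by linarith
      then show "k \<le> \<kappa> x" by (subst (asm) power_strict_increasing_iff) auto
    next
      assume "k \<le> \<kappa> x"
      then have "(2::real) ^ k \<le> 2 ^ \<kappa> x" by (intro power_increasing) auto
      then show "2 ^ k < G x" using \<kappa>(1)[OF that] by linarith
    qed
    define N where "N = Suc (Max (\<kappa> ` hcube n))"
    have N: "\<kappa> x < N" if "x \<in> hcube n" for x
      using that by (simp add: N_def finite_hcube less_Suc_eq_le)
    define A where "A x = (if 1 < G x then level_weight p (\<kappa> x) else 0)" for x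
    define W where "W x = (\<Sum>k<N. level_weight p k * clip (2 ^ k) (G x))" for x
    define V where "V x = (\<Sum>k<N. level_coeff p k * (if 2 ^ k < G x then 1 + 3 * (M x / G x) else 0))" for x
    have lw: "0 \<le> level_weight p k" and lc: "0 \<le> level_coeff p k" for k
      by (auto simp: level_weight_def level_coeff_def)
    have WV: "hcube_mean n W \<le> 2 * hcube_mean n V"
    proof -
      have "hcube_mean n W = (\<Sum>k<N. level_coeff p k * (sqrt (real (Suc k)) * hcube_mean n (\<lambda>x. clip (2 ^ k) (G x))))"
        unfolding W_def hcube_mean_sum hcube_mean_cmult level_coeff_mult[symmetric] by (simp add: mult.assoc)
      also have "\<dots> \<le> (\<Sum>k<N. level_coeff p k * (2 * hcube_mean n (\<lambda>x. if 2 ^ k < G x then 1 + 3 * (M x / G x) else 0)))"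
        unfolding M_def by (intro sum_mono mult_left_mono level_inequality[OF G p Gp] lc)
      also have "\<dots> = 2 * hcube_mean n V"
        unfolding V_def hcube_mean_sum hcube_mean_cmult sum_distrib_left by (simp add: mult.left_commute)
      finally show ?thesis .
    qed
    \<comment> \<open>The truncation at 2^k reaches 1 only from 2^(k+1) on, so level \<kappa> x is
      detected one level below, at the cost of 3^p. Level 0 has weight 1 and gives the additive
      1.\<close>
    have AW: "A x \<le> 1 + 3 powr p * W x" if x: "x \<in> hcube n" for x
    proof (cases "1 < G x \<and> 0 < \<kappa> x")
      case True
      then obtain k where k: "\<kappa> x = Suc k" by (cases "\<kappa> x") auto
      have "level_weight p k = level_weight p k * clip (2 ^ k) (G x)"
        using \<kappa>(1)[of x] True k by (simp add: clip_eq_1)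
      also have "\<dots> \<le> W x"
        unfolding W_def using N[OF x] k lw clip_bounds
        by (intro member_le_sum) auto
      finally have "level_weight p k \<le> W x" .
      then have "3 powr p * level_weight p k \<le> 3 powr p * W x" by (intro mult_left_mono) auto
      with level_weight_Suc_le[OF p, of k] have "level_weight p (Suc k) \<le> 3 powr p * W x"
        by (rule order_trans)
      then show ?thesis using True k by (simp add: A_def)
    next
      case False
      have "0 \<le> W x" unfolding W_def by (intro sum_nonneg mult_nonneg_nonneg lw clip_bounds)
      moreover have "A x \<le> 1" using False by (auto simp: A_def level_weight_def)
      ultimately show ?thesis by (simp add: add_increasing2)
    qed
    \<comment> \<open>Only levels k \<le> \<kappa> x contribute and the top coefficient dominates;
      Young then splits off \<epsilon> A.\<close>
    have VA: "V x \<le> 2 * (\<epsilon> * A x + \<epsilon> powr (1 - p) * (2 powr p * (G x powr p + 3 powr p * M x powr p)))"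
      if x: "x \<in> hcube n" for x
    proof (cases "1 < G x")
      case False
      have "V x = 0"
        unfolding V_def
      proof (intro sum.neutral ballI)
        fix k
        have "(1::real) \<le> 2 ^ k" by simp
        then have "\<not> 2 ^ k < G x" using False by linarith
        then show "level_coeff p k * (if 2 ^ k < G x then 1 + 3 * (M x / G x) else 0) = 0" by simp
      qed
      then show ?thesis using False \<epsilon> by (simp add: A_def)
    next
      case True
      define z where "z = (2::real) ^ \<kappa> x"
      have z: "0 < z" "z < G x" using \<kappa>(1)[OF True] by (auto simp: z_def)
      have "V x = (\<Sum>k<N. if k \<le> \<kappa> x then level_coeff p k * (1 + 3 * (M x / G x)) else 0)"
        unfolding V_def using \<kappa>_iff[OF True] by (intro sum.cong) auto
      also have "\<dots> = (\<Sum>k\<le>\<kappa> x. level_coeff p k * (1 + 3 * (M x / G x)))"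
        using N[OF x] by (intro sum.mono_neutral_cong_right) auto
      also have "\<dots> = (\<Sum>k\<le>\<kappa> x. level_coeff p k) * (1 + 3 * (M x / G x))"
        by (simp add: sum_distrib_right)
      also have "\<dots> \<le> (2 * level_coeff p (\<kappa> x)) * (1 + 3 * (M x / z))"
      proof (intro mult_mono sum_level_coeff_le p)
        have "M x / G x \<le> M x / z" using M[of x] z by (intro divide_left_mono) auto
        then show "1 + 3 * (M x / G x) \<le> 1 + 3 * (M x / z)" by simp
        show "0 \<le> 2 * level_coeff p (\<kappa> x)" using lc by simp
        show "0 \<le> 1 + 3 * (M x / G x)" using M[of x] G[of x] by simp
      qed
      also have "\<dots> = 2 * ((z * sqrt (real (Suc (\<kappa> x)))) powr (p - 1) * (z + 3 * M x))"
      proof -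
        have "z * (1 + 3 * (M x / z)) = z + 3 * M x" using z by (simp add: distrib_left)
        then show ?thesis unfolding level_coeff_def z_def by (simp only: mult.assoc)
      qed
      also have "\<dots> \<le> 2 * (\<epsilon> * (z * sqrt (real (Suc (\<kappa> x)))) powr p + \<epsilon> powr (1 - p) * (z + 3 * M x) powr p)"
        using z M[of x] \<epsilon> p by (intro mult_left_mono powr_mult_le) auto
      also have "\<dots> \<le> 2 * (\<epsilon> * A x + \<epsilon> powr (1 - p) * (2 powr p * (G x powr p + 3 powr p * M x powr p)))"
      proof (intro mult_left_mono add_mono)
        show "(z * sqrt (real (Suc (\<kappa> x)))) powr p \<le> A x"
          using True by (simp add: A_def level_weight_def z_def)
        have "(z + 3 * M x) powr p \<le> (G x + 3 * M x) powr p"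
          using z M[of x] p by (intro powr_mono2) auto
        also have "\<dots> \<le> 2 powr p * (G x powr p + (3 * M x) powr p)"
          using G M[of x] p by (intro powr_add_le) auto
        also have "(3 * M x) powr p = 3 powr p * M x powr p" using M[of x] by (simp add: powr_mult)
        finally show "(z + 3 * M x) powr p \<le> 2 powr p * (G x powr p + 3 powr p * M x powr p)" .
      qed (use \<epsilon> in auto)
      finally show ?thesis .
    qed
    define Q where "Q = \<epsilon> powr (1 - p) * (2 powr p * (1 + 3 powr p))"
    have "hcube_mean n V \<le> hcube_mean n (\<lambda>x. 2 * (\<epsilon> * A x + \<epsilon> powr (1 - p) * (2 powr p * (G x powr p + 3 powr p * M x powr p))))"
      by (intro hcube_mean_mono VA)
    also have "\<dots> = 2 * (\<epsilon> * hcube_mean n A + \<epsilon> powr (1 - p) * (2 powr p *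
        (hcube_mean n (\<lambda>x. G x powr p) + 3 powr p * hcube_mean n (\<lambda>x. M x powr p))))"
      unfolding hcube_mean_cmult hcube_mean_add ..
    also have "\<dots> \<le> 2 * (\<epsilon> * hcube_mean n A + Q)"
    proof -
      have "3 powr p * hcube_mean n (\<lambda>x. M x powr p) \<le> 3 powr p * 1"
        using Mp[folded M_def] by (intro mult_left_mono) auto
      then have "hcube_mean n (\<lambda>x. G x powr p) + 3 powr p * hcube_mean n (\<lambda>x. M x powr p) \<le> 1 + 3 powr p"
        using Gp by linarith
      then show ?thesis unfolding Q_def by (intro mult_left_mono add_left_mono) auto
    qed
    finally have VQ: "hcube_mean n V \<le> 2 * (\<epsilon> * hcube_mean n A + Q)" .
    have "hcube_mean n A \<le> hcube_mean n (\<lambda>x. 1 + 3 powr p * W x)"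
      by (intro hcube_mean_mono AW)
    also have "\<dots> = 1 + 3 powr p * hcube_mean n W"
      unfolding hcube_mean_add hcube_mean_cmult hcube_mean_const ..
    also have "\<dots> \<le> 1 + 3 powr p * (4 * (\<epsilon> * hcube_mean n A + Q))"
      using WV VQ by (intro add_left_mono mult_left_mono) auto
    also have "\<dots> = 1 + (4 * 3 powr p * \<epsilon>) * hcube_mean n A + 4 * 3 powr p * Q"
      by (simp add: algebra_simps)
    also have "4 * 3 powr p * \<epsilon> = 1 / 4" by (simp add: \<epsilon>_def)
    finally have "hcube_mean n A \<le> 1 + 1 / 4 * hcube_mean n A + 4 * 3 powr p * Q" .
    moreover have "0 \<le> 3 powr p * Q" by (simp add: Q_def)
    moreover have "A0 = 2 + 16 * (3 powr p * Q)" by (simp add: A0_def Q_def)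
    ultimately have EA: "hcube_mean n A \<le> A0" by linarith
    have "hcube_mean n (\<lambda>x. LlogL_fun p (p/2) (G x)) \<le> hcube_mean n (\<lambda>x. 2 powr p * (2 + p) powr (p/2) * (1 + A x))"
    proof (intro hcube_mean_mono)
      fix x
      show "LlogL_fun p (p/2) (G x) \<le> 2 powr p * (2 + p) powr (p/2) * (1 + A x)"
      proof (cases "1 < G x")
        case True
        have "LlogL_fun p (p/2) (G x) \<le> 2 powr p * (2 + p) powr (p/2) * level_weight p (\<kappa> x)"
          by (rule LlogL_fun_le_level_weight[OF G \<kappa>(2)[OF True] p])
        also have "\<dots> \<le> 2 powr p * (2 + p) powr (p/2) * (1 + A x)"
          using True by (intro mult_left_mono) (auto simp: A_def)
        finally show ?thesis .
      next
        case False
        then have "LlogL_fun p (p/2) (G x) \<le> 2 powr p * (2 + p) powr (p/2) * level_weight p 0"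
          by (intro LlogL_fun_le_level_weight[OF G _ p]) auto
        then show ?thesis using False by (simp add: A_def level_weight_def)
      qed
    qed
    also have "\<dots> = 2 powr p * (2 + p) powr (p/2) * (1 + hcube_mean n A)"
      unfolding hcube_mean_cmult hcube_mean_add hcube_mean_const ..
    also have "\<dots> \<le> C"
      unfolding C_def using EA by (intro mult_left_mono) auto
    finally show ?thesis .
  qed
  moreover have "0 < C" unfolding C_def using A0 p by simp
  ultimately show thesis using that by blast
qed

text \<open>Turns a bounded modular into a bounded norm: the power gains at least the factor 1/c
  because p \<ge> 1, and the logarithm only decreases.\<close>

lemma LlogL_fun_divide_le:
  assumes "1 \<le> p" "1 \<le> c" "0 \<le> t"
  shows "LlogL_fun p (p/2) (t / c) \<le> (1 / c) * LlogL_fun p (p/2) t"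
proof -
  have "(t / c) powr p = (1 / c) powr p * t powr p"
    using assms by (simp add: powr_divide)
  also have "\<dots> \<le> (1 / c) powr 1 * t powr p"
    using assms by (intro mult_right_mono powr_mono') auto
  finally have 1: "(t / c) powr p \<le> (1 / c) * t powr p" using assms by simp
  have "t / c \<le> t" using assms by (simp add: divide_le_eq mult_le_cancel_left1)
  then have "(t / c) powr p \<le> t powr p" using assms by (intro powr_mono2) auto
  moreover have "1 \<le> exp (1::real)" by simp
  ultimately have "ln (exp 1 + (t / c) powr p) powr (p/2) \<le> ln (exp 1 + t powr p) powr (p/2)"
    using assms by (intro powr_mono2 ln_ge_zero) (auto simp: add_increasing2 add_pos_nonneg)
  with 1 show ?thesis
    unfolding LlogL_fun_def mult.assoc[symmetric] using assms by (intro mult_mono) auto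
qed

section \<open>The norms of the statement in terms of cube means\<close>

lemma Lp_norm_powr:
  assumes "1 \<le> p" shows "Lp_norm n p g powr p = hcube_mean n (\<lambda>x. norm (g x) powr p)"
  using assms hcube_mean_nonneg[of n "\<lambda>x. norm (g x) powr p"]
  by (simp add: Lp_norm_def integral_hcube_measure powr_powr)

lemma LlogL_norm_le:
  assumes "0 < \<gamma>" "hcube_mean n (\<lambda>x. LlogL_fun p \<alpha> (norm (g x) / \<gamma>)) \<le> 1"
  shows "LlogL_norm n p \<alpha> g \<le> \<gamma>"
  unfolding LlogL_norm_def integral_hcube_measure
  by (rule cInf_lower) (use assms in \<open>auto intro: bdd_belowI[of _ 0]\<close>)

text \<open>The centre c cancels in differences. The constant 10 is Khinchine's 5 times 2, the
  latter undoing the 1/2 in \<open>hcube_deriv\<close>.\<close>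

lemma upgrad2_norm_le:
  fixes f :: "(nat \<Rightarrow> real) \<Rightarrow> 'a::real_normed_vector"
  shows "sqrt (upgrad2 n (\<lambda>x. norm (f x - c)) x)
    \<le> 10 * hcube_mean n (\<lambda>\<delta>. norm (\<Sum>i=1..n. \<delta> i *\<^sub>R hcube_deriv i f x))"
proof -
  define S where "S = hcube_mean n (\<lambda>\<delta>. norm (\<Sum>i=1..n. \<delta> i *\<^sub>R hcube_deriv i f x))"
  have S: "0 \<le> S" unfolding S_def by (intro hcube_mean_nonneg) simp
  have "upgrad2 n (\<lambda>x. norm (f x - c)) x
    \<le> 25 * (hcube_mean n (\<lambda>\<delta>. norm (\<Sum>i=1..n. \<delta> i *\<^sub>R (f x - f (x(i := - x i))))))\<^sup>2"
    using norm_decrease_le_rademacher[of "f x - c" "\<lambda>i. f x - f (x(i := - x i))" n]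
    by (simp add: upgrad2_def)
  also have "(\<lambda>\<delta>. norm (\<Sum>i=1..n. \<delta> i *\<^sub>R (f x - f (x(i := - x i)))))
    = (\<lambda>\<delta>. 2 * norm (\<Sum>i=1..n. \<delta> i *\<^sub>R hcube_deriv i f x))"
  proof
    fix \<delta> :: "nat \<Rightarrow> real"
    have "(\<Sum>i=1..n. \<delta> i *\<^sub>R (f x - f (x(i := - x i)))) = 2 *\<^sub>R (\<Sum>i=1..n. \<delta> i *\<^sub>R hcube_deriv i f x)"
      by (simp add: hcube_deriv_def scaleR_sum_right)
    then show "norm (\<Sum>i=1..n. \<delta> i *\<^sub>R (f x - f (x(i := - x i)))) = 2 * norm (\<Sum>i=1..n. \<delta> i *\<^sub>R hcube_deriv i f x)"
      by simp
  qed
  also have "25 * (hcube_mean n \<dots>)\<^sup>2 = (10 * S)\<^sup>2"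
    unfolding hcube_mean_cmult S_def by (simp add: power_mult_distrib)
  finally show ?thesis using S by (intro real_le_lsqrt) (auto simp: S_def)
qed

theorem theorem1:
  fixes p :: real
  assumes "finite_cotype TYPE('a::banach)"
    and "1 \<le> p"
  shows "\<exists>K>0. \<forall>(n::nat) (f :: (nat \<Rightarrow> real) \<Rightarrow> 'a).
    LlogL_norm n p (p/2) (\<lambda>x. f x - hcube_mean n f)
      \<le> K * (\<integral>\<delta>. Lp_norm n p (\<lambda>x. \<Sum>i=1..n. \<delta> i *\<^sub>R hcube_deriv i f x) powr p
               \<partial>hcube_measure n) powr (1/p)"
proof -
  obtain C where C: "0 < C" "\<And>n (f :: (nat \<Rightarrow> real) \<Rightarrow> 'a).
    hcube_mean n (\<lambda>x. norm (f x - hcube_mean n f) powr p)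
    \<le> C * hcube_mean n (\<lambda>x. hcube_mean n (\<lambda>\<delta>. norm (\<Sum>i=1..n. \<delta> i *\<^sub>R hcube_deriv i f x) powr p))"
    by (rule poincare_finite_cotype[OF assms]) blast
  obtain L where L: "0 < L" "\<And>n G. (\<And>x. 0 \<le> G x) \<Longrightarrow> hcube_mean n (\<lambda>x. G x powr p) \<le> 1 \<Longrightarrow>
    hcube_mean n (\<lambda>x. sqrt (upgrad2 n G x) powr p) \<le> 1 \<Longrightarrow>
    hcube_mean n (\<lambda>x. LlogL_fun p (p/2) (G x)) \<le> L"
    by (rule scalar_LlogL[OF assms(2)]) blast
  \<comment> \<open>One constant for both the Poincare bound and the gradient bound, so that a
    single \<gamma> normalizes both hypotheses of \<open>scalar_LlogL\<close>.\<close>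
  define C' where "C' = max C (10 powr p)"
  define c where "c = max L 1"
  define K where "K = c * C' powr (1/p)"
  have C': "0 < C'" "C \<le> C'" "10 powr p \<le> C'" using C by (auto simp: C'_def)
  have c: "1 \<le> c" "L \<le> c" by (auto simp: c_def)
  have "LlogL_norm n p (p/2) (\<lambda>x. f x - hcube_mean n f)
      \<le> K * (\<integral>\<delta>. Lp_norm n p (\<lambda>x. \<Sum>i=1..n. \<delta> i *\<^sub>R hcube_deriv i f x) powr p
               \<partial>hcube_measure n) powr (1/p)" for n and f :: "(nat \<Rightarrow> real) \<Rightarrow> 'a"
  proof -
    define g where "g x = norm (f x - hcube_mean n f)" for x
    define S where "S x = hcube_mean n (\<lambda>\<delta>. norm (\<Sum>i=1..n. \<delta> i *\<^sub>R hcube_deriv i f x) powr p)" for x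
    define R where "R = hcube_mean n S"
    \<comment> \<open>Fubini: the statement averages over x first, the pointwise estimates over
      \<delta> first.\<close>
    have R: "(\<integral>\<delta>. Lp_norm n p (\<lambda>x. \<Sum>i=1..n. \<delta> i *\<^sub>R hcube_deriv i f x) powr p \<partial>hcube_measure n) = R"
      unfolding R_def S_def integral_hcube_measure Lp_norm_powr[OF assms(2)]
      unfolding hcube_mean_eq_wmean by (rule wmean_commute)
    have R0: "0 \<le> R" unfolding R_def S_def by (intro hcube_mean_nonneg) auto
    have gR: "hcube_mean n (\<lambda>x. g x powr p) \<le> C' * R"
    proof -
      have "hcube_mean n (\<lambda>x. g x powr p) \<le> C * R"
        unfolding g_def R_def S_def by (rule C(2))
      also have "\<dots> \<le> C' * R" using C' R0 by (intro mult_right_mono)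
      finally show ?thesis .
    qed
    have MR: "hcube_mean n (\<lambda>x. sqrt (upgrad2 n g x) powr p) \<le> C' * R"
    proof -
      have "hcube_mean n (\<lambda>x. sqrt (upgrad2 n g x) powr p) \<le> hcube_mean n (\<lambda>x. 10 powr p * S x)"
      proof (intro hcube_mean_mono)
        fix x
        let ?E = "hcube_mean n (\<lambda>\<delta>. norm (\<Sum>i=1..n. \<delta> i *\<^sub>R hcube_deriv i f x))"
        have E: "0 \<le> ?E" by (intro hcube_mean_nonneg) simp
        have "sqrt (upgrad2 n g x) powr p \<le> (10 * ?E) powr p"
          unfolding g_def using assms(2) by (intro powr_mono2 upgrad2_norm_le) (auto simp: upgrad2_nonneg)
        also have "\<dots> = 10 powr p * ?E powr p" using E by (simp add: powr_mult)
        also have "\<dots> \<le> 10 powr p * S x"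
          unfolding S_def using assms(2) by (intro mult_left_mono hcube_mean_powr_le) auto
        finally show "sqrt (upgrad2 n g x) powr p \<le> 10 powr p * S x" .
      qed
      also have "\<dots> = 10 powr p * R" unfolding hcube_mean_cmult R_def ..
      also have "\<dots> \<le> C' * R" using C' R0 by (intro mult_right_mono)
      finally show ?thesis .
    qed
    show ?thesis
    \<comment> \<open>For R = 0 nothing can be normalized, but g vanishes on the cube and every
      positive \<gamma> is admissible.\<close>
    proof (cases "R = 0")
      case True
      have g0: "g x = 0" if "x \<in> hcube n" for x
      proof -
        have "hcube_mean n (\<lambda>x. g x powr p) = 0"
          using gR True hcube_mean_nonneg[of n "\<lambda>x. g x powr p"] by simp
        from hcube_mean_eq_0D[OF this _ that] show ?thesis by simp
      qed
      have "LlogL_norm n p (p/2) (\<lambda>x. f x - hcube_mean n f) \<le> \<gamma>" if "0 < \<gamma>" for \<gamma>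
      proof (rule LlogL_norm_le[OF that])
        have "hcube_mean n (\<lambda>x. LlogL_fun p (p/2) (norm (f x - hcube_mean n f) / \<gamma>)) = hcube_mean n (\<lambda>_. 0)"
          using g0 by (intro hcube_mean_cong) (simp add: g_def LlogL_fun_def)
        then show "hcube_mean n (\<lambda>x. LlogL_fun p (p/2) (norm (f x - hcube_mean n f) / \<gamma>)) \<le> 1"
          by (simp add: hcube_mean_const)
      qed
      then have "LlogL_norm n p (p/2) (\<lambda>x. f x - hcube_mean n f) \<le> 0"
        by (rule dense_ge)
      then show ?thesis unfolding R by (simp add: True)
    next
      case False
      define \<gamma> where "\<gamma> = (C' * R) powr (1/p)"
      have CR: "0 < C' * R" using False R0 C' by simp
      have \<gamma>: "0 < \<gamma>" "\<gamma> powr p = C' * R" using CR assms(2) by (auto simp: \<gamma>_def powr_powr)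
      define G where "G x = g x / \<gamma>" for x
      have G: "0 \<le> G x" for x using \<gamma> by (simp add: G_def g_def)
      have "hcube_mean n (\<lambda>x. G x powr p) = (1 / (C' * R)) * hcube_mean n (\<lambda>x. g x powr p)"
        unfolding hcube_mean_cmult[symmetric] using \<gamma> by (simp add: G_def g_def powr_divide)
      also have "\<dots> \<le> 1" using gR CR by (simp add: divide_le_eq)
      finally have Gp: "hcube_mean n (\<lambda>x. G x powr p) \<le> 1" .
      have up: "sqrt (upgrad2 n G x) = sqrt (upgrad2 n g x) / \<gamma>" for x
      proof -
        have "max 0 (G x - G y) = max 0 (g x - g y) / \<gamma>" for y
          using \<gamma> by (auto simp: G_def max_def diff_divide_distrib[symmetric] zero_le_divide_iff divide_le_0_iff)
        then have "upgrad2 n G x = upgrad2 n g x / \<gamma>\<^sup>2"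
          by (simp add: upgrad2_def power_divide sum_divide_distrib)
        then show ?thesis using \<gamma> by (simp add: real_sqrt_divide)
      qed
      have "hcube_mean n (\<lambda>x. sqrt (upgrad2 n G x) powr p) = (1 / (C' * R)) * hcube_mean n (\<lambda>x. sqrt (upgrad2 n g x) powr p)"
        unfolding hcube_mean_cmult[symmetric] up using \<gamma> by (simp add: powr_divide upgrad2_nonneg)
      also have "\<dots> \<le> 1" using MR CR by (simp add: divide_le_eq)
      finally have Mp: "hcube_mean n (\<lambda>x. sqrt (upgrad2 n G x) powr p) \<le> 1" .
      have "LlogL_norm n p (p/2) (\<lambda>x. f x - hcube_mean n f) \<le> c * \<gamma>"
      proof (rule LlogL_norm_le)
        show "0 < c * \<gamma>" using c \<gamma> by simp
        have "hcube_mean n (\<lambda>x. LlogL_fun p (p/2) (norm (f x - hcube_mean n f) / (c * \<gamma>)))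
          = hcube_mean n (\<lambda>x. LlogL_fun p (p/2) (G x / c))"
          by (simp add: G_def g_def mult.commute)
        also have "\<dots> \<le> hcube_mean n (\<lambda>x. (1 / c) * LlogL_fun p (p/2) (G x))"
          by (intro hcube_mean_mono LlogL_fun_divide_le assms c G)
        also have "\<dots> \<le> (1 / c) * L"
          unfolding hcube_mean_cmult using L(2)[OF G Gp Mp] c by (intro mult_left_mono) auto
        also have "\<dots> \<le> 1" using c by simp
        finally show "hcube_mean n (\<lambda>x. LlogL_fun p (p/2) (norm (f x - hcube_mean n f) / (c * \<gamma>))) \<le> 1" .
      qed
      also have "c * \<gamma> = K * R powr (1/p)"
        using C' R0 by (simp add: \<gamma>_def K_def powr_mult)
      finally show ?thesis unfolding R .
    qed
  qed
  moreover have "0 < K" using C' c by (simp add: K_def)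
  ultimately show ?thesis by blast
qed

end
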